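(* Let $\{\varphi_n\}_{n=0}^\infty$ be a linearly dense stationary sequence of unit vectors in a Hilbert space $H$ with singular spectral measure $\mu$, and let $b$ and $\{\alpha_n\}_{n\ge 0}$ be the associated inner function and coefficient sequence. Let $\vec{x}\in H$, and suppose the noise $\{\epsilon_n\}_{n=0}^\infty\subset\mathbb{C}$, with $\varepsilon(z)=\sum_{n=0}^\infty \epsilon_n z^n$, is such that $(1-b)\varepsilon\in H^2\ominus b^K H^2$ for some $K\in\mathbb{N}=\{1,2,\dots\}$. Then: (1) the series $$\vec{x}_\infty=\sum_{n=0}^\infty\Big(\sum_{j=0}^n\alpha_{n-j}\langle \vec{x},\varphi_j\rangle\Big)\varphi_n \quad\text{and}\quad E_\epsilon=\sum_{n=0}^\infty\Big(\sum_{j=0}^n\alpha_{n-j}\epsilon_j\Big)\varphi_n$$ both converge in $H$; (2) $\|E_\epsilon\|_H\le 2K^{1/2}\,\|\{\epsilon_n\}\|_{\ell^2}$ (where the right-hand side is $+\infty$ if $\{\epsilon_n\}\notin\ell^2$).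
   Context: $H$ is a complex Hilbert space with inner product linear in the first variable. A sequence $\{\varphi_n\}_{n=0}^\infty$ of unit vectors is stationary if $\langle\varphi_{n+k},\varphi_{m+k}\rangle=\langle\varphi_n,\varphi_m\rangle$ for all $n,m,k\in\mathbb{N}_0$. Its spectral measure is the Borel probability measure $\mu$ on $[0,1)$ with $\langle\varphi_n,\varphi_m\rangle=\int_0^1 e^{2\pi i(n-m)x}\,d\mu(x)$; it is singular if it is singular with respect to Lebesgue measure. Linearly dense means the linear span is dense in $H$. Let $\mu^+(z)=\int_0^1\frac{1}{1-ze^{-2\pi i x}}\,d\mu(x)$ for $z$ in the open unit disc $\mathbb{D}$, and $b(z)=1-\frac{1}{\mu^+(z)}$; for $\mu$ singular, $b$ is an inner function with $b(0)=0$. The sequence $\{\alpha_n\}$ is defined by $1-b(z)=\sum_{n=0}^\infty\alpha_n z^n$. $H^2=H^2(\mathbb{D})$ is the Hardy space on $\mathbb{D}$, and $H^2\ominus b^KH^2$ is the orthogonal complement of $b^KH^2$ in $H^2$. It is assumed that the power series $\varepsilon(z)$ has radius of convergence at least $1$. *)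

theory Defs
  imports "HOL-Probability.Probability" "HOL-Complex_Analysis.Complex_Analysis"
begin

section \<open>Complex Hilbert spaces\<close>

text \<open>
  A complex inner product space is a real normed space whose scalar multiplication extends to
  the complex numbers and whose norm comes from a sesquilinear form, linear in the first variable.
  Positive definiteness of \<open>cinner\<close> follows from \<open>cinner_self\<close> and the norm axioms.
\<close>

class complex_inner = real_normed_vector +
  fixes scaleC :: "complex \<Rightarrow> 'a \<Rightarrow> 'a" (infixr \<open>*\<^sub>C\<close> 75)
    and cinner :: "'a \<Rightarrow> 'a \<Rightarrow> complex"
  assumes scaleC_add_right: "a *\<^sub>C (x + y) = a *\<^sub>C x + a *\<^sub>C y"
    and scaleC_add_left: "(a + b) *\<^sub>C x = a *\<^sub>C x + b *\<^sub>C x"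
    and scaleC_scaleC: "a *\<^sub>C b *\<^sub>C x = (a * b) *\<^sub>C x"
    and scaleC_of_real: "complex_of_real r *\<^sub>C x = r *\<^sub>R x"
    and cinner_commute: "cinner x y = cnj (cinner y x)"
    and cinner_add_left: "cinner (x + y) z = cinner x z + cinner y z"
    and cinner_scaleC_left: "cinner (a *\<^sub>C x) y = a * cinner x y"
    and cinner_self: "cinner x x = complex_of_real ((norm x)\<^sup>2)"

class complex_hilbert = complex_inner + complete_space

lemma vector_space_scaleC: "vector_space (scaleC :: complex \<Rightarrow> 'a::complex_inner \<Rightarrow> 'a)"
proof
  fix x :: 'a
  show "1 *\<^sub>C x = x"
    using scaleC_of_real[of 1 x] by simp
qed (rule scaleC_add_right scaleC_add_left scaleC_scaleC)+

instantiation complex :: complex_hilbert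
begin

definition "scaleC_complex (a::complex) (x::complex) = a * x"
definition "cinner_complex (x::complex) (y::complex) = x * cnj y"

instance
proof
  fix a b x y z :: complex and r :: real
  show "cinner x x = complex_of_real ((norm x)\<^sup>2)"
    unfolding cinner_complex_def by (rule complex_norm_square[symmetric])
qed (simp_all add: scaleC_complex_def cinner_complex_def distrib_left distrib_right
    scaleR_conv_of_real)

end

definition cspan :: "'a::complex_inner set \<Rightarrow> 'a set" where
  "cspan = module.span scaleC"

definition linearly_dense :: "(nat \<Rightarrow> 'a::complex_inner) \<Rightarrow> bool" where
  "linearly_dense \<phi> \<longleftrightarrow> closure (cspan (range \<phi>)) = UNIV"


section \<open>Stationary sequences and their spectral measures\<close>

definition stationary :: "(nat \<Rightarrow> 'a::complex_inner) \<Rightarrow> bool" where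
  "stationary \<phi> \<longleftrightarrow>
     (\<forall>n. norm (\<phi> n) = 1) \<and>
     (\<forall>n m k. cinner (\<phi> (n + k)) (\<phi> (m + k)) = cinner (\<phi> n) (\<phi> m))"

definition spectral_measure :: "(nat \<Rightarrow> 'a::complex_inner) \<Rightarrow> real measure \<Rightarrow> bool" where
  "spectral_measure \<phi> \<mu> \<longleftrightarrow>
     prob_space \<mu> \<and>
     space \<mu> = {0..<1} \<and> sets \<mu> = sets (restrict_space borel {0..<1}) \<and>
     (\<forall>n m. cinner (\<phi> n) (\<phi> m) =
        (LINT x|\<mu>. exp (2 * complex_of_real pi * \<i> * (of_nat n - of_nat m) * complex_of_real x)))"

definition mutually_singular :: "'a measure \<Rightarrow> 'a measure \<Rightarrow> bool" where
  "mutually_singular M N \<longleftrightarrow>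
     sets M = sets N \<and> (\<exists>A\<in>sets M. emeasure M A = 0 \<and> emeasure N (space N - A) = 0)"

definition singular_measure :: "real measure \<Rightarrow> bool" where
  "singular_measure \<mu> \<longleftrightarrow> mutually_singular \<mu> (restrict_space lborel {0..<1})"


section \<open>The associated inner function and coefficient sequence\<close>

definition mu_plus :: "real measure \<Rightarrow> complex \<Rightarrow> complex" where
  "mu_plus \<mu> z =
     (LINT x|\<mu>. 1 / (1 - z * exp (- 2 * complex_of_real pi * \<i> * complex_of_real x)))"

definition inner_fun :: "real measure \<Rightarrow> complex \<Rightarrow> complex" where
  "inner_fun \<mu> z = 1 - 1 / mu_plus \<mu> z"

definition alpha_coeffs :: "real measure \<Rightarrow> (nat \<Rightarrow> complex) \<Rightarrow> bool" where
  "alpha_coeffs \<mu> \<alpha> \<longleftrightarrow>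
     (\<forall>z\<in>ball 0 1. (\<lambda>n. \<alpha> n * z ^ n) sums (1 - inner_fun \<mu> z))"


section \<open>The Hardy space of the unit disc\<close>

text \<open>
  Elements of the Hardy space are represented by functions on the whole plane; only their
  values on the open unit disc matter.
\<close>

definition taylor_coeff :: "(complex \<Rightarrow> complex) \<Rightarrow> nat \<Rightarrow> complex" where
  "taylor_coeff f n = fps_nth (fps_expansion f 0) n"

definition hardy2 :: "(complex \<Rightarrow> complex) set" where
  "hardy2 = {f. f holomorphic_on ball 0 1 \<and> summable (\<lambda>n. (cmod (taylor_coeff f n))\<^sup>2)}"

definition hardy2_inner :: "(complex \<Rightarrow> complex) \<Rightarrow> (complex \<Rightarrow> complex) \<Rightarrow> complex" where
  "hardy2_inner f g = (\<Sum>n. taylor_coeff f n * cnj (taylor_coeff g n))"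

definition hardy2_ominus :: "(complex \<Rightarrow> complex) set \<Rightarrow> (complex \<Rightarrow> complex) set" where
  "hardy2_ominus M = {f \<in> hardy2. \<forall>g\<in>M. hardy2_inner f g = 0}"

definition mult_hardy2 :: "(complex \<Rightarrow> complex) \<Rightarrow> (complex \<Rightarrow> complex) set" where
  "mult_hardy2 h = {(\<lambda>z. h z * g z) | g. g \<in> hardy2}"


section \<open>The extended \<open>\<ell>\<^sup>2\<close> norm\<close>

definition l2_norm :: "(nat \<Rightarrow> complex) \<Rightarrow> ereal" where
  "l2_norm x =
     (if summable (\<lambda>n. (cmod (x n))\<^sup>2) then ereal (sqrt (\<Sum>n. (cmod (x n))\<^sup>2)) else \<infinity>)"

end

theory Submission
  imports Defs
begin

text \<open>
  Sequences are treated as formal power series. Let \<open>A\<close> have the coefficients \<open>\<alpha>\<^sub>n\<close>, let \<open>B = 1 - A\<close> be the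
  series of \<open>b\<close>, and let \<open>X\<^sub>x\<close> have the coefficients \<open>\<langle>x, \<phi>\<^sub>n\<rangle>\<close>. The Kaczmarz iteration with an additional input
  \<open>u\<close> is an energy preserving linear system with output \<open>A X\<^sub>x + B u\<close>; its state after \<open>N\<close> steps is \<open>x\<close> minus the
  \<open>N\<close>-th partial sum of \<open>\<Sum> (A (X\<^sub>x - u))\<^sub>n \<phi>\<^sub>n\<close>. Singularity of \<open>\<mu>\<close> enters only through \<open>\<Sum> |B\<^sub>n|\<^sup>2 = 1\<close>. This makes the
  state vanish in the limit, first for inputs that are monomials and then for all square summable inputs and all
  initial states. Hence \<open>(x, u) \<mapsto> A X\<^sub>x + B u\<close> is isometric, and running the system backwards in time
  shows that it maps onto all square summable sequences. Iterating \<open>c = A X\<^sub>x + B u\<close> exactly \<open>K\<close> times writes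
  \<open>c\<close> as \<open>\<Sum>\<^sub>k\<^sub><\<^sub>K B\<^sup>k A X\<^sub>y\<^sub>k + B\<^sup>K u\<close> with \<open>\<Sum> \<parallel>y\<^sub>k\<parallel>\<^sup>2 + \<parallel>u\<parallel>\<^sup>2 = \<parallel>c\<parallel>\<^sup>2\<close>. For \<open>c\<close> orthogonal to \<open>b\<^sup>K H\<^sup>2\<close> the remainder \<open>u\<close> vanishes, and
  since multiplication by \<open>B\<close> does not change \<open>\<Sum> c\<^sub>n \<phi>\<^sub>n\<close>, that series converges to \<open>\<Sum> y\<^sub>k\<close>.

  For \<open>\<Sum> |B\<^sub>n|\<^sup>2 = 1\<close>, note that \<open>0 \<le> 1 - |b|\<^sup>2 \<le> min(1, 4 P\<mu>)\<close> for the Poisson integral \<open>P\<mu>\<close>. Since \<open>\<mu>\<close> is carried,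
  up to small mass, by a compact null set, the mean of this bound over the circle of radius \<open>r\<close> becomes
  arbitrarily small as \<open>r\<close> tends to 1.
\<close>

section \<open>Square summable sequences\<close>

lemma cinner_add_right: "cinner x (y + z) = cinner x y + cinner x z" for x :: "'a::complex_inner"
  by (metis cinner_commute cinner_add_left complex_cnj_add)

lemma cinner_scaleC_right: "cinner x (a *\<^sub>C y) = cnj a * cinner x y" for x :: "'a::complex_inner"
  by (metis cinner_commute cinner_scaleC_left complex_cnj_mult)

lemma cinner_diff_left: "cinner (x - y) z = cinner x z - cinner y z" for x :: "'a::complex_inner"
  by (metis cinner_add_left add_diff_cancel diff_add_cancel)

lemma cinner_diff_right: "cinner x (y - z) = cinner x y - cinner x z" for x :: "'a::complex_inner"
  by (metis cinner_add_right add_diff_cancel diff_add_cancel)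

lemma cinner_zero_left [simp]: "cinner 0 y = 0" for y :: "'a::complex_inner"
  using cinner_diff_left[of y y y] by simp

lemma cinner_sum_left: "cinner (\<Sum>i\<in>I. f i) z = (\<Sum>i\<in>I. cinner (f i) z)"
  for z :: "'a::complex_inner"
  by (induction I rule: infinite_finite_induct) (simp_all add: cinner_add_left)

lemma scaleC_zero_left [simp]: "0 *\<^sub>C x = 0" for x :: "'a::complex_inner"
  using scaleC_of_real[of 0 x] by simp

lemma scaleC_zero_right [simp]: "a *\<^sub>C 0 = 0" for a :: complex
  using scaleC_add_right[of a "0 :: 'a::complex_inner" 0] by simp

lemma scaleC_one [simp]: "1 *\<^sub>C x = x" for x :: "'a::complex_inner"
  using scaleC_of_real[of 1 x] by simp

lemma scaleC_minus_left: "(- a) *\<^sub>C x = - (a *\<^sub>C x)" for x :: "'a::complex_inner"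
  using scaleC_add_left[of "- a" a x] by (simp add: eq_neg_iff_add_eq_0)

lemma scaleC_diff_left: "(a - b) *\<^sub>C x = a *\<^sub>C x - b *\<^sub>C x" for x :: "'a::complex_inner"
  using scaleC_add_left[of a "- b" x] by (simp add: scaleC_minus_left)

lemma scaleC_diff_right: "a *\<^sub>C (x - y) = a *\<^sub>C x - a *\<^sub>C y" for x :: "'a::complex_inner"
  by (metis scaleC_add_right add_diff_cancel diff_add_cancel)

lemma scaleC_sum_right: "a *\<^sub>C (\<Sum>i\<in>I. f i) = (\<Sum>i\<in>I. a *\<^sub>C f i)"
  for f :: "'i \<Rightarrow> 'a::complex_inner"
  by (induction I rule: infinite_finite_induct) (simp_all add: scaleC_add_right)

lemma norm_scaleC: "norm (a *\<^sub>C x) = cmod a * norm x" for x :: "'a::complex_inner"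
proof -
  have "complex_of_real ((norm (a *\<^sub>C x))\<^sup>2) = complex_of_real ((cmod a * norm x)\<^sup>2)"
    unfolding cinner_self[symmetric] cinner_scaleC_left cinner_scaleC_right
    by (simp add: cinner_self power_mult_distrib complex_norm_square mult_ac del: of_real_power)
  then show ?thesis
    by (subst (asm) of_real_eq_iff) (simp add: power2_eq_iff_nonneg)
qed

text \<open>The vector on the left keeps the part of \<open>s\<close> orthogonal to \<open>p\<close>
  and has component \<open>u\<close> along \<open>p\<close>, so Pythagoras applies. This is the
  energy balance of one Kaczmarz step.\<close>

lemma norm_exchange_component:
  fixes s p :: "'a::complex_inner"
  assumes "norm p = 1"
  shows "(norm (s - (cinner s p - u) *\<^sub>C p))\<^sup>2 = (norm s)\<^sup>2 - (cmod (cinner s p))\<^sup>2 + (cmod u)\<^sup>2"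
proof -
  define y where "y = cinner s p"
  have "cinner p s = cnj y"
    by (metis cinner_commute y_def)
  moreover have "cinner p p = 1"
    by (simp add: cinner_self assms)
  ultimately have "complex_of_real ((norm (s - (y - u) *\<^sub>C p))\<^sup>2)
      = cinner s s - y * cnj y + u * cnj u"
    unfolding cinner_self[symmetric]
    by (simp add: cinner_diff_left cinner_diff_right cinner_scaleC_left cinner_scaleC_right
        flip: y_def) (simp add: algebra_simps)
  also have "\<dots> = complex_of_real ((norm s)\<^sup>2 - (cmod y)\<^sup>2 + (cmod u)\<^sup>2)"
    by (simp add: cinner_self flip: complex_norm_square del: of_real_power)
  finally show ?thesis
    unfolding y_def by (subst (asm) of_real_eq_iff)
qed

lemma cmod_cinner_le:
  fixes s p :: "'a::complex_inner"
  assumes "norm p = 1"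
  shows "cmod (cinner s p) \<le> norm s"
proof -
  have "0 \<le> (norm s)\<^sup>2 - (cmod (cinner s p))\<^sup>2"
    using norm_exchange_component[OF assms, of s 0] by (metis add.right_neutral norm_zero
        power_zero_numeral zero_le_power2)
  then show ?thesis
    by (simp add: power2_le_iff_abs_le)
qed

section \<open>Square summable coefficient sequences\<close>

definition l2 :: "complex fps \<Rightarrow> bool" where
  "l2 F \<longleftrightarrow> summable (\<lambda>n. (cmod (fps_nth F n))\<^sup>2)"

text \<open>The square is kept because the energy balances below are additive in it. The value is
  meaningful only under \<open>l2\<close>.\<close>

definition l2sq :: "complex fps \<Rightarrow> real" where
  "l2sq F = (\<Sum>n. (cmod (fps_nth F n))\<^sup>2)"

lemma cmod_add_square_le: "(cmod (a + b))\<^sup>2 \<le> 2 * (cmod a)\<^sup>2 + 2 * (cmod b)\<^sup>2"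
proof -
  have "(cmod (a + b))\<^sup>2 \<le> (cmod a + cmod b)\<^sup>2"
    by (simp add: norm_triangle_ineq power_mono)
  also have "\<dots> \<le> 2 * (cmod a)\<^sup>2 + 2 * (cmod b)\<^sup>2"
    using zero_le_power2[of "cmod a - cmod b"] unfolding power2_sum power2_diff by linarith
  finally show ?thesis .
qed

lemma l2_add: "l2 F \<Longrightarrow> l2 G \<Longrightarrow> l2 (F + G)"
  unfolding l2_def
  by (rule summable_comparison_test'[where N = 0
        and g = "\<lambda>n. 2 * (cmod (fps_nth F n))\<^sup>2 + 2 * (cmod (fps_nth G n))\<^sup>2"])
    (simp_all add: summable_add summable_mult cmod_add_square_le)

lemma l2_uminus: "l2 F \<Longrightarrow> l2 (- F)"
  by (simp add: l2_def)

lemma l2_diff: "l2 F \<Longrightarrow> l2 G \<Longrightarrow> l2 (F - G)"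
  using l2_add[OF _ l2_uminus] by force

lemma l2_cutoff: "l2 (fps_cutoff n F)"
  unfolding l2_def by (rule summable_finite[of "{..<n}"]) auto

lemma l2_one: "l2 1" "l2sq 1 = 1"
proof -
  have "(\<lambda>n. (cmod (fps_nth 1 n))\<^sup>2) = (\<lambda>n. if n = 0 then 1 else 0)"
    by auto
  then have "(\<lambda>n. (cmod (fps_nth 1 n))\<^sup>2) sums 1"
    using sums_single[of 0 "\<lambda>_. 1 :: real"] by simp
  then show "l2 1" "l2sq 1 = 1"
    by (simp_all add: l2_def l2sq_def sums_iff)
qed

lemma l2sq_nonneg: "l2 F \<Longrightarrow> 0 \<le> l2sq F"
  unfolding l2_def l2sq_def by (rule suminf_nonneg) auto

lemma sum_le_l2sq: "l2 F \<Longrightarrow> (\<Sum>n<N. (cmod (fps_nth F n))\<^sup>2) \<le> l2sq F"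
  unfolding l2_def l2sq_def by (rule sum_le_suminf) auto

lemma norm_nth_le_l2sq:
  assumes "l2 F"
  shows "(cmod (fps_nth F n))\<^sup>2 \<le> l2sq F"
proof -
  have "0 \<le> (\<Sum>k<n. (cmod (fps_nth F k))\<^sup>2)"
    by (simp add: sum_nonneg)
  then show ?thesis
    using sum_le_l2sq[OF assms, of "Suc n"] by simp
qed

lemma l2sq_LIMSEQ: "l2 F \<Longrightarrow> (\<lambda>N. \<Sum>n<N. (cmod (fps_nth F n))\<^sup>2) \<longlonglongrightarrow> l2sq F"
  unfolding l2_def l2sq_def by (rule summable_LIMSEQ)

lemma l2I_bounded:
  assumes "\<And>N. (\<Sum>n<N. (cmod (fps_nth F n))\<^sup>2) \<le> C"
  shows "l2 F" and "l2sq F \<le> C"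
proof -
  show "l2 F"
    unfolding l2_def by (rule summableI_nonneg_bounded[OF _ assms]) auto
  then show "l2sq F \<le> C"
    using LIMSEQ_le_const2[OF l2sq_LIMSEQ] assms by blast
qed

lemma l2_eq_0:
  assumes "l2 F" and "l2sq F \<le> 0"
  shows "F = 0"
proof (rule fps_ext)
  fix n
  have "(cmod (fps_nth F n))\<^sup>2 \<le> 0"
    using norm_nth_le_l2sq[OF assms(1), of n] assms(2) by linarith
  then show "fps_nth F n = fps_nth 0 n"
    by simp
qed

lemma l2sq_tail_LIMSEQ:
  assumes "l2 F"
  shows "(\<lambda>n. l2sq (F - fps_cutoff n F)) \<longlonglongrightarrow> 0"
proof -
  have s: "summable (\<lambda>n. (cmod (fps_nth F n))\<^sup>2)"
    using assms by (simp add: l2_def)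
  have "l2sq (F - fps_cutoff n F) = l2sq F - (\<Sum>k<n. (cmod (fps_nth F k))\<^sup>2)" for n
  proof -
    have "l2sq F = (\<Sum>k. (cmod (fps_nth F (k + n)))\<^sup>2) + (\<Sum>k<n. (cmod (fps_nth F k))\<^sup>2)"
      unfolding l2sq_def by (rule suminf_split_initial_segment[OF s])
    moreover have "l2sq (F - fps_cutoff n F)
        = (\<Sum>k. (cmod (fps_nth (F - fps_cutoff n F) (k + n)))\<^sup>2)
          + (\<Sum>k<n. (cmod (fps_nth (F - fps_cutoff n F) k))\<^sup>2)"
      unfolding l2sq_def
      by (rule suminf_split_initial_segment) (use l2_diff[OF assms l2_cutoff] in \<open>simp add: l2_def\<close>)
    ultimately show ?thesis
      by simp
  qed
  then show ?thesis
    using tendsto_diff[OF tendsto_const[of "l2sq F"] l2sq_LIMSEQ[OF assms]] by simp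
qed

lemma l2sq_mono:
  assumes "\<And>n. cmod (fps_nth F n) \<le> cmod (fps_nth G n)" and "l2 G"
  shows "l2 F" and "l2sq F \<le> l2sq G"
proof -
  have "(\<Sum>n<N. (cmod (fps_nth F n))\<^sup>2) \<le> l2sq G" for N
    by (rule order_trans[OF sum_mono sum_le_l2sq[OF assms(2)]]) (simp add: assms(1) power_mono)
  then show "l2 F" and "l2sq F \<le> l2sq G"
    by (rule l2I_bounded)+
qed

lemma l2sq_diff_orthogonal:
  assumes "l2 F" "l2 G" and orth: "(\<Sum>n. fps_nth F n * cnj (fps_nth G n)) = 0"
  shows "l2sq (F - G) = l2sq F + l2sq G"
proof -
  let ?p = "\<lambda>n. fps_nth F n * cnj (fps_nth G n)"
  have sF: "(\<lambda>n. (cmod (fps_nth F n))\<^sup>2) sums l2sq F" and sG: "(\<lambda>n. (cmod (fps_nth G n))\<^sup>2) sums l2sq G"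
    using assms by (simp_all add: l2_def l2sq_def summable_sums)
  have bound: "cmod (?p n) \<le> (cmod (fps_nth F n))\<^sup>2 + (cmod (fps_nth G n))\<^sup>2" for n
  proof -
    have "0 \<le> cmod (fps_nth F n) * cmod (fps_nth G n)"
      by simp
    then show ?thesis
      using sum_squares_bound[of "cmod (fps_nth F n)" "cmod (fps_nth G n)"]
      unfolding norm_mult complex_mod_cnj by linarith
  qed
  \<comment> \<open>Summability turns \<open>orth\<close>, an equation about the value of
    \<open>suminf\<close>, into a statement about a convergent series.\<close>
  have "summable ?p"
    by (rule summable_comparison_test'[OF summable_add[OF assms(1,2)[unfolded l2_def]] bound])
  then have "?p sums 0"
    using orth by (simp add: sums_iff)
  then have "(\<lambda>n. Re (?p n)) sums 0"
    using sums_Re by fastforce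
  then have "(\<lambda>n. (cmod (fps_nth F n))\<^sup>2 + (cmod (fps_nth G n))\<^sup>2 - 2 * Re (?p n))
      sums (l2sq F + l2sq G - 2 * 0)"
    by (intro sums_add sums_diff sums_mult sF sG)
  moreover have "(cmod (fps_nth F n))\<^sup>2 + (cmod (fps_nth G n))\<^sup>2 - 2 * Re (?p n)
      = (cmod (fps_nth (F - G) n))\<^sup>2" for n
    by (simp add: cmod_power2 power2_diff)
  ultimately show ?thesis
    by (simp add: l2sq_def sums_iff)
qed

section \<open>The Kaczmarz system\<close>

text \<open>For a spectral measure, \<open>a\<close> is the expansion of \<open>mu_plus\<close> and
  its inverse \<open>A\<close> that of 1 - b. The correlations with k \<le> n are those that enter
  when the state \<open>x - S n F\<close> is paired with \<open>\<phi>\<^sub>n\<close>.\<close>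

locale stationary_gram =
  fixes \<phi> :: "nat \<Rightarrow> 'a::complex_hilbert" and A a :: "complex fps"
  assumes norm_\<phi>: "norm (\<phi> n) = 1"
    and gram: "k \<le> n \<Longrightarrow> cinner (\<phi> k) (\<phi> n) = fps_nth a (n - k)"
    and A_a: "A * a = 1"
begin

definition B :: "complex fps" where "B = 1 - A"

definition X :: "'a \<Rightarrow> complex fps" where "X x = Abs_fps (\<lambda>n. cinner x (\<phi> n))"

definition S :: "nat \<Rightarrow> complex fps \<Rightarrow> 'a" where "S N F = (\<Sum>n<N. fps_nth F n *\<^sub>C \<phi> n)"

lemma X_nth [simp]: "fps_nth (X x) n = cinner x (\<phi> n)"
  by (simp add: X_def)

lemma X_add: "X (x + y) = X x + X y"
  by (rule fps_ext) (simp add: cinner_add_left)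

lemma X_diff: "X (x - y) = X x - X y"
  by (rule fps_ext) (simp add: cinner_diff_left)

lemma X_scaleC: "X (r *\<^sub>C x) = fps_const r * X x"
  by (rule fps_ext) (simp add: cinner_scaleC_left)

lemma X_zero [simp]: "X 0 = 0"
  by (rule fps_ext) simp

lemma S_add: "S N (F + G) = S N F + S N G"
  by (simp add: S_def scaleC_add_left sum.distrib)

lemma S_diff: "S N (F - G) = S N F - S N G"
  by (simp add: S_def scaleC_diff_left sum_subtractf)

lemma S_const_mult: "S N (fps_const r * F) = r *\<^sub>C S N F"
  by (simp add: S_def scaleC_sum_right scaleC_scaleC)

lemma S_Suc: "S (Suc N) F = S N F + fps_nth F N *\<^sub>C \<phi> N"
  by (simp add: S_def)

lemma S_zero [simp]: "S N 0 = 0" "S 0 F = 0"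
  by (simp_all add: S_def)

text \<open>The convolution \<open>F * a\<close> collects the correlations of all
  \<open>\<phi>\<^sub>k\<close> with k \<le> n, while \<open>S n F\<close> stops before n. The
  missing term is \<open>F\<^sub>n\<close>, because \<open>a\<close> has constant term 1.\<close>

lemma cinner_state:
  "cinner (x - S n F) (\<phi> n) = cinner x (\<phi> n) - fps_nth (F * a) n + fps_nth F n"
proof -
  have "fps_nth a 0 = 1"
    using gram[of 0 0] by (simp add: cinner_self norm_\<phi>)
  then have "fps_nth (F * a) n = (\<Sum>k<n. fps_nth F k * fps_nth a (n - k)) + fps_nth F n"
    by (simp add: fps_mult_nth atLeast0AtMost flip: lessThan_Suc_atMost)
  moreover have "cinner (S n F) (\<phi> n) = (\<Sum>k<n. fps_nth F k * fps_nth a (n - k))"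
    by (simp add: S_def cinner_sum_left cinner_scaleC_left gram)
  ultimately show ?thesis
    by (simp add: cinner_diff_left)
qed

text \<open>
  One Kaczmarz step with input \<open>u\<^sub>n\<close> replaces the component of the state along \<open>\<phi>\<^sub>n\<close> by \<open>u\<^sub>n\<close> and
  outputs the old component, so it conserves energy. Started in \<open>x\<close>, the recursion has the output
  sequence \<open>A X\<^sub>x + B u\<close>.
\<close>

lemma energy:
  "(norm (x - S N (A * (X x - u))))\<^sup>2
     = (norm x)\<^sup>2 + (\<Sum>n<N. (cmod (fps_nth u n))\<^sup>2)
       - (\<Sum>n<N. (cmod (fps_nth (A * X x + B * u) n))\<^sup>2)"
proof (induction N)
  case (Suc N)
  define F where "F = A * (X x - u)"
  define s where "s = x - S N F"
  \<comment> \<open>Since \<open>A\<close> inverts \<open>a\<close>, the component of the state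
    along \<open>\<phi>\<^sub>N\<close> becomes \<open>F\<^sub>N + u\<^sub>N\<close>, which is the
    claimed output.\<close>
  have "F * a = X x - u"
    using A_a by (metis F_def mult.assoc mult.commute mult.right_neutral)
  then have s: "cinner s (\<phi> N) = fps_nth F N + fps_nth u N"
    by (simp add: s_def cinner_state)
  define Y where "Y = A * X x + B * u"
  have "F + u = Y"
    by (simp add: F_def Y_def B_def algebra_simps)
  then have y: "fps_nth F N = fps_nth Y N - fps_nth u N" "cinner s (\<phi> N) = fps_nth Y N"
    unfolding s by auto
  have "x - S (Suc N) F = s - (fps_nth Y N - fps_nth u N) *\<^sub>C \<phi> N"
    by (simp add: s_def S_Suc y(1))
  then have "(norm (x - S (Suc N) F))\<^sup>2
      = (norm s)\<^sup>2 - (cmod (fps_nth Y N))\<^sup>2 + (cmod (fps_nth u N))\<^sup>2"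
    using norm_exchange_component[OF norm_\<phi>, of s N "fps_nth u N"] by (simp only: y(2))
  then show ?case
    using Suc.IH unfolding F_def[symmetric] s_def[symmetric] Y_def[symmetric] by simp
qed simp

lemma energy_input:
  "(norm (S N (A * u)))\<^sup>2
     = (\<Sum>n<N. (cmod (fps_nth u n))\<^sup>2) - (\<Sum>n<N. (cmod (fps_nth (B * u) n))\<^sup>2)"
  using energy[of 0 N u] S_diff[of N 0 "A * u"] by simp

lemma energy_state:
  "(norm (x - S N (A * X x)))\<^sup>2 = (norm x)\<^sup>2 - (\<Sum>n<N. (cmod (fps_nth (A * X x) n))\<^sup>2)"
  using energy[of x N 0] by simp

text \<open>Started in 0, the system holds the state \<open>- S N (A * u)\<close>, whose nonnegative
  energy is the excess of input over output.\<close>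

lemma B_contraction:
  assumes "l2 u"
  shows "l2 (B * u)" and "l2sq (B * u) \<le> l2sq u"
proof -
  have "(\<Sum>n<N. (cmod (fps_nth (B * u) n))\<^sup>2) \<le> l2sq u" for N
    using energy_input[of N u] sum_le_l2sq[OF assms, of N] zero_le_power2[of "norm (S N (A * u))"]
    by linarith
  then show "l2 (B * u)" and "l2sq (B * u) \<le> l2sq u"
    by (rule l2I_bounded)+
qed

text \<open>The same balance read for the state: stored energy never exceeds the input energy,
  uniformly in N.\<close>

lemma norm_S_A_le:
  assumes "l2 u"
  shows "(norm (S N (A * u)))\<^sup>2 \<le> l2sq u"
proof -
  have "0 \<le> (\<Sum>n<N. (cmod (fps_nth (B * u) n))\<^sup>2)"
    by (simp add: sum_nonneg)
  then show ?thesis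
    using energy_input[of N u] sum_le_l2sq[OF assms, of N] by linarith
qed

lemma norm_state_le: "norm (x - S N (A * X x)) \<le> norm x"
proof -
  have "(norm (x - S N (A * X x)))\<^sup>2 \<le> (norm x)\<^sup>2"
    unfolding energy_state by (simp add: sum_nonneg)
  then show ?thesis
    by (simp add: power2_le_iff_abs_le)
qed

text \<open>By \<open>cinner_state\<close>, prescribed components of the states amount to the
  convolution equation \<open>X x - u = (c - u) * a\<close>, which multiplication by
  \<open>A\<close> solves.\<close>

lemma output_eqI:
  assumes "\<And>n. cinner (x - S n (c - u)) (\<phi> n) = fps_nth c n"
  shows "A * X x + B * u = c"
proof -
  have "X x - u = (c - u) * a"
  proof (rule fps_ext)
    fix n
    show "fps_nth (X x - u) n = fps_nth ((c - u) * a) n"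
      using assms[of n] unfolding cinner_state by (simp add: algebra_simps)
  qed
  then have "A * (X x - u) = c - u"
    using A_a by (metis mult.assoc mult.commute mult.right_neutral)
  then show ?thesis
    by (simp add: B_def algebra_simps)
qed

text \<open>One step reversed: the component of the later state along \<open>\<phi>\<^sub>n\<close>
  was the input, and it is exchanged for the prescribed output \<open>c n\<close>. The final state
  varies in the induction, since the hypothesis is applied to the state one step earlier.\<close>

lemma backward_states:
  "\<exists>s. s N = z \<and> (\<forall>n<N. s n = s (Suc n) + (c n - cinner (s (Suc n)) (\<phi> n)) *\<^sub>C \<phi> n)"
proof (induction N arbitrary: z)
  case 0
  show ?case
    by auto
next
  case (Suc N)
  obtain s where "s N = z + (c N - cinner z (\<phi> N)) *\<^sub>C \<phi> N"
    and "\<forall>n<N. s n = s (Suc n) + (c n - cinner (s (Suc n)) (\<phi> n)) *\<^sub>C \<phi> n"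
    using Suc.IH by blast
  then have "(s(Suc N := z)) (Suc N) = z \<and> (\<forall>n<Suc N. (s(Suc N := z)) n = (s(Suc N := z)) (Suc n)
      + (c n - cinner ((s(Suc N := z)) (Suc n)) (\<phi> n)) *\<^sub>C \<phi> n)"
    by (auto simp: less_Suc_eq)
  then show ?case
    by blast
qed

text \<open>
  The recursion can be run backwards in time: from the final state \<open>0\<close>, prescribed outputs
  determine the inputs and the initial state.
\<close>

lemma output_surj_cutoff: "\<exists>x u. l2 u \<and> A * X x + B * u = fps_cutoff N c"
proof -
  obtain s where sN: "s N = 0"
    and s: "\<And>n. n < N \<Longrightarrow>
      s n = s (Suc n) + (fps_nth c n - cinner (s (Suc n)) (\<phi> n)) *\<^sub>C \<phi> n"
    using backward_states[of N 0 "fps_nth c"] by blast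
  \<comment> \<open>The input at time n is what the forward step leaves along
    \<open>\<phi>\<^sub>n\<close>, so it is read off from the later state.\<close>
  define u where "u = fps_cutoff N (Abs_fps (\<lambda>n. cinner (s (Suc n)) (\<phi> n)))"
  define F where "F = fps_cutoff N c - u"
  have states: "s 0 - S n F = s n" if "n \<le> N" for n
    using that
  proof (induction n)
    case (Suc n)
    then have "s 0 - S (Suc n) F = s n - fps_nth F n *\<^sub>C \<phi> n"
      by (simp add: S_Suc)
    also have "\<dots> = s (Suc n)"
      using s[of n] Suc.prems by (simp add: F_def u_def)
    finally show ?case .
  qed simp
  have "A * X (s 0) + B * u = fps_cutoff N c"
  proof (rule output_eqI)
    fix n
    show "cinner (s 0 - S n (fps_cutoff N c - u)) (\<phi> n) = fps_nth (fps_cutoff N c) n"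
    proof (cases "n < N")
      case True
      then show ?thesis
        using states[of n] s[of n] cinner_self[of "\<phi> n"]
        by (simp add: F_def cinner_add_left cinner_scaleC_left norm_\<phi>)
    next
      case False
      \<comment> \<open>From time N on both \<open>c\<close> (cut off) and \<open>u\<close> vanish,
        so the state rests at its final value 0.\<close>
      then have "S n F = S N F"
        unfolding S_def by (intro sum.mono_neutral_right) (auto simp: F_def u_def)
      then show ?thesis
        using False states[of N] sN by (simp add: F_def)
    qed
  qed
  moreover have "l2 u"
    unfolding u_def by (rule l2_cutoff)
  ultimately show ?thesis
    by blast
qed

end

text \<open>Inductive step of Cauchy-Schwarz for K + 1 summands, with \<open>D\<close> in the role
  of the sum of squares of K of them and \<open>q\<close> of their sum. It comes from
  \<open>(K p - q)\<^sup>2 \<ge> 0\<close> after division by K.\<close>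

lemma sum_square_le_Suc:
  fixes p q D :: real
  assumes "q\<^sup>2 \<le> real K * D" and "0 \<le> q" and "0 \<le> D"
  shows "(p + q)\<^sup>2 \<le> real (Suc K) * (p\<^sup>2 + D)"
proof (cases "K = 0")
  case True
  then show ?thesis
    using assms by simp
next
  case False
  have "0 \<le> (real K * p - q)\<^sup>2"
    by simp
  then have "2 * real K * (p * q) \<le> real K * (real K * p\<^sup>2) + q\<^sup>2"
    by (simp add: power2_diff power_mult_distrib power2_eq_square algebra_simps)
  also have "\<dots> \<le> real K * (real K * p\<^sup>2 + D)"
    using assms(1) by (simp add: distrib_left)
  finally have "2 * (p * q) \<le> real K * p\<^sup>2 + D"
    using False by (simp add: mult.assoc mult.left_commute[of 2])
  then show ?thesis
    using assms(1) by (simp add: power2_sum algebra_simps)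
qed

section \<open>Effectiveness and losslessness of the Kaczmarz system\<close>

locale effective_gram = stationary_gram +
  assumes dense: "linearly_dense \<phi>"
    and B_unit: "l2sq B = 1"
begin

lemma S_A_fps_X_power: "(\<lambda>N. S N (A * fps_X ^ k)) \<longlonglongrightarrow> 0"
proof -
  have "l2 B"
    using B_contraction(1)[OF l2_one(1)] by simp
  \<comment> \<open>At time Suc k + N the unit impulse at k has been fed in, and the shifted output
    has emitted exactly the coefficients of \<open>B\<close> below Suc N.\<close>
  have "(norm (S (Suc k + N) (A * fps_X ^ k)))\<^sup>2 = 1 - (\<Sum>n<Suc N. (cmod (fps_nth B n))\<^sup>2)" for N
  proof -
    have "(\<Sum>n<Suc k + N. (cmod (fps_nth (fps_X ^ k :: complex fps) n))\<^sup>2)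
        = (\<Sum>n<Suc k + N. if n = k then 1 else 0)"
      by (intro sum.cong) auto
    then have "(\<Sum>n<Suc k + N. (cmod (fps_nth (fps_X ^ k :: complex fps) n))\<^sup>2) = 1"
      by simp
    moreover have "(\<Sum>n<Suc k + N. (cmod (fps_nth (B * fps_X ^ k) n))\<^sup>2)
        = (\<Sum>n\<in>{k..<Suc k + N}. (cmod (fps_nth B (n - k)))\<^sup>2)"
      by (intro sum.mono_neutral_cong_right) (auto simp: fps_X_power_mult_right_nth)
    then have "(\<Sum>n<Suc k + N. (cmod (fps_nth (B * fps_X ^ k) n))\<^sup>2)
        = (\<Sum>n<Suc N. (cmod (fps_nth B n))\<^sup>2)"
      using sum.shift_bounds_nat_ivl[of "\<lambda>n. (cmod (fps_nth B (n - k)))\<^sup>2" 0 k "Suc N"]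
      by (simp add: atLeast0LessThan add.commute)
    ultimately show ?thesis
      by (simp add: energy_input)
  qed
  moreover have "(\<lambda>N. 1 - (\<Sum>n<Suc N. (cmod (fps_nth B n))\<^sup>2)) \<longlonglongrightarrow> 1 - 1"
    using LIMSEQ_Suc[OF l2sq_LIMSEQ[OF \<open>l2 B\<close>]] unfolding B_unit
    by (rule tendsto_diff[OF tendsto_const])
  ultimately have "(\<lambda>N. (norm (S (N + Suc k) (A * fps_X ^ k)))\<^sup>2) \<longlonglongrightarrow> 0"
    by (simp add: add.commute)
  then have "(\<lambda>N. sqrt ((norm (S (N + Suc k) (A * fps_X ^ k)))\<^sup>2)) \<longlonglongrightarrow> sqrt 0"
    by (rule tendsto_real_sqrt)
  then have "(\<lambda>N. S (N + Suc k) (A * fps_X ^ k)) \<longlonglongrightarrow> 0"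
    by (simp add: tendsto_norm_zero_iff)
  then show ?thesis
    by (rule LIMSEQ_offset)
qed

lemma S_A_cutoff: "(\<lambda>N. S N (A * fps_cutoff k u)) \<longlonglongrightarrow> 0"
proof (induction k)
  case (Suc k)
  have "fps_cutoff (Suc k) u = fps_cutoff k u + fps_const (fps_nth u k) * fps_X ^ k"
    by (rule fps_ext) (auto simp: less_Suc_eq)
  then have "S N (A * fps_cutoff (Suc k) u)
      = S N (A * fps_cutoff k u) + fps_nth u k *\<^sub>C S N (A * fps_X ^ k)" for N
    by (simp add: distrib_left S_add mult.left_commute flip: S_const_mult)
  moreover have "(\<lambda>N. fps_nth u k *\<^sub>C S N (A * fps_X ^ k)) \<longlonglongrightarrow> 0"
    using tendsto_mult_right_zero[OF tendsto_norm_zero[OF S_A_fps_X_power[of k]],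
        of "cmod (fps_nth u k)"]
    by (subst tendsto_norm_zero_iff[symmetric]) (simp add: norm_scaleC)
  ultimately show ?case
    using tendsto_add[OF Suc.IH] by simp
qed simp

text \<open>Finitely supported inputs are dense, and \<open>norm_S_A_le\<close> bounds the remainder
  uniformly in N.\<close>

lemma S_A_tendsto_0:
  assumes "l2 u"
  shows "(\<lambda>N. S N (A * u)) \<longlonglongrightarrow> 0"
proof (rule LIMSEQ_I)
  fix e :: real assume "e > 0"
  then have "eventually (\<lambda>k. l2sq (u - fps_cutoff k u) < (e / 2)\<^sup>2) sequentially"
    using order_tendstoD(2)[OF l2sq_tail_LIMSEQ[OF assms], of "(e / 2)\<^sup>2"] by simp
  then obtain k where k: "l2sq (u - fps_cutoff k u) < (e / 2)\<^sup>2"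
    by (auto simp: eventually_sequentially)
  obtain N0 where N0: "\<And>N. N \<ge> N0 \<Longrightarrow> norm (S N (A * fps_cutoff k u)) < e / 2"
    using LIMSEQ_D[OF S_A_cutoff[of k u], of "e / 2"] \<open>e > 0\<close> by auto
  have "norm (S N (A * u) - 0) < e" if "N \<ge> N0" for N
  proof -
    have "(norm (S N (A * (u - fps_cutoff k u))))\<^sup>2 < (e / 2)\<^sup>2"
      using norm_S_A_le[OF l2_diff[OF assms l2_cutoff]] k by (rule le_less_trans)
    then have "norm (S N (A * (u - fps_cutoff k u))) < e / 2"
      by (rule power_less_imp_less_base) (use \<open>e > 0\<close> in simp)
    moreover have "S N (A * u) = S N (A * (u - fps_cutoff k u)) + S N (A * fps_cutoff k u)"
      by (simp add: right_diff_distrib flip: S_add)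
    ultimately show ?thesis
      using norm_triangle_ineq[of "S N (A * (u - fps_cutoff k u))" "S N (A * fps_cutoff k u)"]
        N0[OF that] by simp
  qed
  then show "\<exists>no. \<forall>n\<ge>no. norm (S n (A * u) - 0) < e"
    by blast
qed

text \<open>By stationarity the coefficients of \<open>X (\<phi> k)\<close> from index k on form
  \<open>fps_X ^ k * a\<close>. Multiplication by \<open>A\<close> turns this into
  \<open>fps_X ^ k\<close>, whose partial sums reproduce \<open>\<phi> k\<close>; the finitely many
  earlier coefficients fall under \<open>S_A_cutoff\<close>.\<close>

lemma S_A_X_\<phi>: "(\<lambda>N. \<phi> k - S N (A * X (\<phi> k))) \<longlonglongrightarrow> 0"
proof -
  have "X (\<phi> k) = fps_cutoff k (X (\<phi> k)) + fps_X ^ k * a"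
    by (rule fps_ext) (auto simp: fps_X_power_mult_nth gram)
  then have "A * X (\<phi> k) = A * fps_cutoff k (X (\<phi> k)) + fps_X ^ k"
    using A_a by (metis distrib_left mult.assoc mult.commute mult.left_neutral)
  then have *: "\<phi> k - S N (A * X (\<phi> k)) = \<phi> k - S N (fps_X ^ k) - S N (A * fps_cutoff k (X (\<phi> k)))"
    for N
    by (simp add: S_add)
  have "S N (fps_X ^ k) = \<phi> k" if "N > k" for N
  proof -
    have "S N (fps_X ^ k) = (\<Sum>n<N. if n = k then \<phi> n else 0)"
      unfolding S_def by (intro sum.cong) auto
    then show ?thesis
      using that by simp
  qed
  then have "eventually (\<lambda>N. - S N (A * fps_cutoff k (X (\<phi> k))) = \<phi> k - S N (A * X (\<phi> k))) sequentially"
    unfolding * eventually_sequentially by (intro exI[of _ "Suc k"]) simp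
  moreover have lim: "(\<lambda>N. - S N (A * fps_cutoff k (X (\<phi> k)))) \<longlonglongrightarrow> 0"
    using tendsto_minus[OF S_A_cutoff] by simp
  ultimately show ?thesis
    by (intro Lim_transform_eventually[OF lim])
qed

lemma S_A_X_span:
  assumes "x \<in> cspan (range \<phi>)"
  shows "(\<lambda>N. x - S N (A * X x)) \<longlonglongrightarrow> 0"
proof -
  interpret vector_space "scaleC :: complex \<Rightarrow> 'a \<Rightarrow> 'a"
    by (rule vector_space_scaleC)
  show ?thesis
    using assms unfolding cspan_def
  proof (induction rule: span_induct_alt)
    case base
    then show ?case
      by simp
  next
    case (step c p y)
    then obtain k where p: "p = \<phi> k"
      by blast
    have "c *\<^sub>C p + y - S N (A * X (c *\<^sub>C p + y))
        = c *\<^sub>C (p - S N (A * X p)) + (y - S N (A * X y))" for N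
      by (simp add: X_add X_scaleC distrib_left S_add mult.left_commute[of A] S_const_mult
          scaleC_diff_right)
    moreover have lim: "(\<lambda>N. c *\<^sub>C (p - S N (A * X p))) \<longlonglongrightarrow> 0"
      using tendsto_mult_right_zero[OF tendsto_norm_zero[OF S_A_X_\<phi>[of k]], of "cmod c"]
      by (subst tendsto_norm_zero_iff[symmetric]) (simp add: norm_scaleC p)
    ultimately show ?case
      using tendsto_add[OF lim step.IH] by (simp only: add_0)
  qed
qed

text \<open>The maps from x to \<open>x - S N (A * X x)\<close> are linear contractions by
  \<open>norm_state_le\<close>, so convergence passes from the dense span to all vectors.\<close>

lemma kaczmarz_effective: "(\<lambda>N. x - S N (A * X x)) \<longlonglongrightarrow> 0"
proof (rule LIMSEQ_I)
  fix e :: real assume "e > 0"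
  have "x \<in> closure (cspan (range \<phi>))"
    using dense by (simp add: linearly_dense_def)
  then obtain y where y: "y \<in> cspan (range \<phi>)" "dist y x < e / 2"
    using \<open>e > 0\<close> by (meson closure_approachable half_gt_zero)
  obtain N0 where N0: "\<And>N. N \<ge> N0 \<Longrightarrow> norm (y - S N (A * X y)) < e / 2"
    using LIMSEQ_D[OF S_A_X_span[OF y(1)], of "e / 2"] \<open>e > 0\<close> by auto
  have "norm (x - S N (A * X x) - 0) < e" if "N \<ge> N0" for N
  proof -
    have "x - S N (A * X x) = (x - y - S N (A * X (x - y))) + (y - S N (A * X y))"
      by (simp add: X_diff right_diff_distrib S_diff)
    then have "norm (x - S N (A * X x)) \<le> norm (x - y) + norm (y - S N (A * X y))"
      using norm_state_le[of "x - y" N]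
      by (metis norm_triangle_le add_right_mono)
    then show ?thesis
      using N0[OF that] y(2) by (simp add: dist_norm norm_minus_commute)
  qed
  then show "\<exists>no. \<forall>n\<ge>no. norm (x - S n (A * X x) - 0) < e"
    by blast
qed

lemma S_A_X_tendsto: "(\<lambda>N. S N (A * X x)) \<longlonglongrightarrow> x"
  using tendsto_diff[OF tendsto_const[of x] kaczmarz_effective[of x]] by simp

text \<open>In the energy balance the state tends to 0, so nothing remains stored.\<close>

lemma output_isometry:
  assumes "l2 u"
  shows "l2 (A * X x + B * u)" and "l2sq (A * X x + B * u) = (norm x)\<^sup>2 + l2sq u"
proof -
  have *: "(\<Sum>n<N. (cmod (fps_nth (A * X x + B * u) n))\<^sup>2)
      = (norm x)\<^sup>2 + (\<Sum>n<N. (cmod (fps_nth u n))\<^sup>2)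
        - (norm (x - S N (A * X x) + S N (A * u)))\<^sup>2" for N
    using energy[of x N u] by (simp add: right_diff_distrib S_diff algebra_simps)
  have "(\<lambda>N. \<Sum>n<N. (cmod (fps_nth (A * X x + B * u) n))\<^sup>2)
      \<longlonglongrightarrow> (norm x)\<^sup>2 + l2sq u - (norm (0 + 0 :: 'a))\<^sup>2"
    unfolding * by (intro tendsto_intros l2sq_LIMSEQ assms kaczmarz_effective S_A_tendsto_0)
  then have "(\<lambda>n. (cmod (fps_nth (A * X x + B * u) n))\<^sup>2) sums ((norm x)\<^sup>2 + l2sq u)"
    by (simp add: sums_def)
  then show "l2 (A * X x + B * u)" and "l2sq (A * X x + B * u) = (norm x)\<^sup>2 + l2sq u"
    by (auto simp: l2_def l2sq_def sums_iff)
qed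

lemma B_isometry: "l2 u \<Longrightarrow> l2sq (B * u) = l2sq u"
  using output_isometry(2)[of u 0] by simp

lemma B_power_isometry:
  assumes "l2 u"
  shows "l2 (B ^ K * u)" and "l2sq (B ^ K * u) = l2sq u"
proof -
  have "l2 (B ^ K * u) \<and> l2sq (B ^ K * u) = l2sq u"
    by (induction K) (simp_all add: assms mult.assoc B_isometry B_contraction)
  then show "l2 (B ^ K * u)" and "l2sq (B ^ K * u) = l2sq u"
    by auto
qed

text \<open>Each truncation of \<open>c\<close> is an output. Isometry makes the initial states
  Cauchy in norm and the inputs Cauchy in each coefficient. Coefficientwise limits suffice, since an
  output coefficient depends on finitely many input coefficients.\<close>

lemma output_surj:
  assumes "l2 c"
  obtains x u where "l2 u" "A * X x + B * u = c"
proof -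
  have "\<forall>N. \<exists>p. l2 (snd p) \<and> A * X (fst p) + B * snd p = fps_cutoff N c"
    using output_surj_cutoff[of _ c] by simp
  from choice[OF this] obtain p
    where p: "\<And>N. l2 (snd (p N)) \<and> A * X (fst (p N)) + B * snd (p N) = fps_cutoff N c"
    by blast
  define xs us where "xs N = fst (p N)" and "us N = snd (p N)" for N
  have us: "\<And>N. l2 (us N)" and eq: "\<And>N. A * X (xs N) + B * us N = fps_cutoff N c"
    using p by (simp_all add: xs_def us_def)
  have diff_le: "(norm (xs M - xs N))\<^sup>2 + l2sq (us M - us N) \<le> l2sq (c - fps_cutoff M c)"
    if "M \<le> N" for M N
  proof -
    have "A * X (xs M - xs N) + B * (us M - us N) = fps_cutoff M c - fps_cutoff N c"
      unfolding eq[symmetric] by (simp add: X_diff algebra_simps)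
    then have "(norm (xs M - xs N))\<^sup>2 + l2sq (us M - us N) = l2sq (fps_cutoff M c - fps_cutoff N c)"
      using output_isometry(2)[OF l2_diff[OF us[of M] us[of N]], of "xs M - xs N"] by simp
    \<comment> \<open>For M \<le> N the two truncations differ only at indices from M on.\<close>
    also have "\<dots> \<le> l2sq (c - fps_cutoff M c)"
      by (rule l2sq_mono(2)[OF _ l2_diff[OF assms l2_cutoff]]) (use that in auto)
    finally show ?thesis .
  qed
  have small: "\<exists>N0. \<forall>M\<ge>N0. l2sq (c - fps_cutoff M c) < e\<^sup>2" if "e > 0" for e :: real
    using order_tendstoD(2)[OF l2sq_tail_LIMSEQ[OF assms], of "e\<^sup>2"] that
    by (simp add: eventually_sequentially)
  have "Cauchy xs"
  proof (rule CauchyI')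
    fix e :: real assume e: "e > 0"
    then obtain N0 where N0: "\<And>M. M \<ge> N0 \<Longrightarrow> l2sq (c - fps_cutoff M c) < e\<^sup>2"
      using small by blast
    have "norm (xs m - xs n) < e" if "m \<ge> N0" "n > m" for m n
      using diff_le[of m n] N0[of m] that l2sq_nonneg[OF l2_diff[OF us[of m] us[of n]]] e
      by (intro power_less_imp_less_base[of "norm (xs m - xs n)" 2 e]) auto
    then show "\<exists>M. \<forall>m\<ge>M. \<forall>n>m. dist (xs m) (xs n) < e"
      unfolding dist_norm by blast
  qed
  then obtain x where x: "xs \<longlonglongrightarrow> x"
    using Cauchy_convergent convergent_def by blast
  have "Cauchy (\<lambda>N. fps_nth (us N) k)" for k
  proof (rule CauchyI')
    fix e :: real assume e: "e > 0"
    then obtain N0 where N0: "\<And>M. M \<ge> N0 \<Longrightarrow> l2sq (c - fps_cutoff M c) < e\<^sup>2"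
      using small by blast
    have "norm (fps_nth (us m) k - fps_nth (us n) k) < e" if "m \<ge> N0" "n > m" for m n
    proof (rule power_less_imp_less_base[of _ 2 e])
      have "(norm (fps_nth (us m - us n) k))\<^sup>2 \<le> l2sq (us m - us n)"
        by (rule norm_nth_le_l2sq[OF l2_diff[OF us us]])
      also have "\<dots> \<le> l2sq (c - fps_cutoff m c)"
        using diff_le[of m n] that zero_le_power2[of "norm (xs m - xs n)"] by linarith
      finally show "(norm (fps_nth (us m) k - fps_nth (us n) k))\<^sup>2 < e\<^sup>2"
        using N0[OF that(1)] by simp
    qed (use e in simp)
    then show "\<exists>M. \<forall>m\<ge>M. \<forall>n>m. dist (fps_nth (us m) k) (fps_nth (us n) k) < e"
      unfolding dist_norm by blast
  qed
  then have "\<exists>v. (\<lambda>N. fps_nth (us N) k) \<longlonglongrightarrow> v" for k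
    using Cauchy_convergent convergent_def by blast
  then obtain v where v: "\<And>k. (\<lambda>N. fps_nth (us N) k) \<longlonglongrightarrow> v k"
    by metis
  have "l2 (Abs_fps v)"
  proof (rule l2I_bounded(1))
    fix K
    have "(\<lambda>N. \<Sum>k<K. (cmod (fps_nth (us N) k))\<^sup>2) \<longlonglongrightarrow> (\<Sum>k<K. (cmod (v k))\<^sup>2)"
      by (intro tendsto_intros v)
    moreover have "(\<Sum>k<K. (cmod (fps_nth (us N) k))\<^sup>2) \<le> l2sq c" for N
    proof -
      have "(\<Sum>k<K. (cmod (fps_nth (us N) k))\<^sup>2) \<le> (norm (xs N))\<^sup>2 + l2sq (us N)"
        using sum_le_l2sq[OF us[of N], of K] by (simp add: add_increasing)
      also have "\<dots> = l2sq (fps_cutoff N c)"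
        using output_isometry(2)[OF us[of N], of "xs N"] by (simp add: eq)
      also have "\<dots> \<le> l2sq c"
        by (rule l2sq_mono(2)[OF _ assms]) simp
      finally show ?thesis .
    qed
    ultimately show "(\<Sum>k<K. (cmod (fps_nth (Abs_fps v) k))\<^sup>2) \<le> l2sq c"
      using LIMSEQ_le_const2 by fastforce
  qed
  moreover have "A * X x + B * Abs_fps v = c"
  proof (rule fps_ext)
    fix n
    have "(\<lambda>N. cinner (xs N) (\<phi> k)) \<longlonglongrightarrow> cinner x (\<phi> k)" for k
    proof -
      have "(\<lambda>N. cinner (xs N - x) (\<phi> k)) \<longlonglongrightarrow> 0"
        by (rule Lim_null_comparison[OF _ tendsto_norm_zero[OF LIM_zero[OF x]]])
          (simp add: cmod_cinner_le norm_\<phi>)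
      then show ?thesis
        by (simp add: cinner_diff_left LIM_zero_iff)
    qed
    then have "(\<lambda>N. fps_nth (A * X (xs N) + B * us N) n) \<longlonglongrightarrow> fps_nth (A * X x + B * Abs_fps v) n"
      unfolding fps_add_nth fps_mult_nth X_nth fps_nth_Abs_fps by (intro tendsto_intros v)
    moreover have "(\<lambda>N. fps_nth (A * X (xs N) + B * us N) n) \<longlonglongrightarrow> fps_nth c n"
      unfolding eq by (rule tendsto_eventually)
        (use eventually_gt_at_top[of n] in \<open>eventually_elim, simp\<close>)
    ultimately show "fps_nth (A * X x + B * Abs_fps v) n = fps_nth c n"
      by (rule LIMSEQ_unique)
  qed
  ultimately show thesis
    by (rule that)
qed

section \<open>Splitting off powers of \<open>B\<close>\<close>

lemma S_B_tendsto:
  assumes "l2 c" and "(\<lambda>N. S N c) \<longlonglongrightarrow> y"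
  shows "(\<lambda>N. S N (B * c)) \<longlonglongrightarrow> y"
proof -
  have "S N (B * c) = S N c - S N (A * c)" for N
    by (simp add: B_def left_diff_distrib flip: S_diff)
  then show ?thesis
    using tendsto_diff[OF assms(2) S_A_tendsto_0[OF assms(1)]] by simp
qed

text \<open>Of the K vectors produced by the iteration only the sum \<open>y\<close> is recorded.
  Their squared norms add up to \<open>l2sq c - l2sq u\<close>, so the factor K is the
  Cauchy-Schwarz constant for K summands.\<close>

lemma output_decomposition:
  assumes "l2 c"
  shows "\<exists>u y. l2 u \<and> l2 (c - B ^ K * u) \<and> l2sq (c - B ^ K * u) = l2sq c - l2sq u
    \<and> (\<lambda>N. S N (c - B ^ K * u)) \<longlonglongrightarrow> y \<and> (norm y)\<^sup>2 \<le> real K * (l2sq c - l2sq u)"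
  using assms
proof (induction K arbitrary: c)
  case 0
  then show ?case
    by (intro exI[of _ c] exI[of _ 0]) (simp add: l2_def l2sq_def)
next
  case (Suc K)
  obtain x d where "l2 d" and c: "A * X x + B * d = c"
    using output_surj[OF Suc.prems] .
  obtain u y where "l2 u" and e: "l2 (d - B ^ K * u)" "l2sq (d - B ^ K * u) = l2sq d - l2sq u"
    "(\<lambda>N. S N (d - B ^ K * u)) \<longlonglongrightarrow> y" and y: "(norm y)\<^sup>2 \<le> real K * (l2sq d - l2sq u)"
    using Suc.IH[OF \<open>l2 d\<close>] by blast
  have split: "c - B ^ Suc K * u = A * X x + B * (d - B ^ K * u)"
    by (simp add: algebra_simps flip: c)
  have l2sq_c: "l2sq c = (norm x)\<^sup>2 + l2sq d"
    using output_isometry(2)[OF \<open>l2 d\<close>] c by metis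
  have "l2 (c - B ^ Suc K * u)" "l2sq (c - B ^ Suc K * u) = l2sq c - l2sq u"
    unfolding split using output_isometry[OF e(1)] e(2) l2sq_c by auto
  moreover have "(\<lambda>N. S N (c - B ^ Suc K * u)) \<longlonglongrightarrow> x + y"
    unfolding split S_add by (intro tendsto_add S_A_X_tendsto S_B_tendsto e)
  moreover have "(norm (x + y))\<^sup>2 \<le> real (Suc K) * (l2sq c - l2sq u)"
  proof -
    have "(norm (x + y))\<^sup>2 \<le> (norm x + norm y)\<^sup>2"
      by (simp add: norm_triangle_ineq power_mono)
    also have "\<dots> \<le> real (Suc K) * ((norm x)\<^sup>2 + (l2sq d - l2sq u))"
      using l2sq_nonneg[OF e(1)] by (intro sum_square_le_Suc[OF y]) (simp_all add: e(2))
    finally show ?thesis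
      by (simp add: l2sq_c add_diff_eq)
  qed
  ultimately show ?case
    using \<open>l2 u\<close> by blast
qed

text \<open>Orthogonality gives \<open>l2sq c + l2sq u\<close> for the remainder by Pythagoras, the
  decomposition gives \<open>l2sq c - l2sq u\<close>; hence \<open>u\<close> vanishes.\<close>

lemma S_tendsto_of_orthogonal:
  assumes "l2 c" and orth: "\<And>u. l2 u \<Longrightarrow> (\<Sum>n. fps_nth c n * cnj (fps_nth (B ^ K * u) n)) = 0"
  shows "\<exists>y. (\<lambda>N. S N c) \<longlonglongrightarrow> y \<and> (norm y)\<^sup>2 \<le> real K * l2sq c"
proof -
  obtain u y where u: "l2 u" "l2sq (c - B ^ K * u) = l2sq c - l2sq u"
    and y: "(\<lambda>N. S N (c - B ^ K * u)) \<longlonglongrightarrow> y" "(norm y)\<^sup>2 \<le> real K * (l2sq c - l2sq u)"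
    using output_decomposition[OF assms(1)] by blast
  have "l2sq (c - B ^ K * u) = l2sq c + l2sq u"
    using l2sq_diff_orthogonal[OF assms(1) B_power_isometry(1) orth] u(1) B_power_isometry(2)
    by metis
  then have "u = 0"
    using u by (intro l2_eq_0) auto
  then show ?thesis
    using y by (auto simp: l2sq_def)
qed

text \<open>Multiplication by \<open>A = 1 - B\<close> has norm at most 2 because \<open>B\<close>
  is a contraction. This is the source of the constant 2 in the final estimate.\<close>

lemma l2sq_A_mult_le:
  assumes "l2 u"
  shows "l2sq (A * u) \<le> 4 * l2sq u"
proof -
  have "A * u = u - B * u"
    by (simp add: B_def algebra_simps)
  then have *: "(cmod (fps_nth (A * u) n))\<^sup>2 \<le> 2 * (cmod (fps_nth u n))\<^sup>2 + 2 * (cmod (fps_nth (B * u) n))\<^sup>2"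
    for n
    using cmod_add_square_le[of "fps_nth u n" "- fps_nth (B * u) n"] by simp
  have "(\<Sum>n<N. (cmod (fps_nth (A * u) n))\<^sup>2) \<le> 4 * l2sq u" for N
  proof -
    have "(\<Sum>n<N. (cmod (fps_nth (A * u) n))\<^sup>2)
        \<le> (\<Sum>n<N. 2 * (cmod (fps_nth u n))\<^sup>2 + 2 * (cmod (fps_nth (B * u) n))\<^sup>2)"
      by (intro sum_mono *)
    also have "\<dots> = 2 * (\<Sum>n<N. (cmod (fps_nth u n))\<^sup>2) + 2 * (\<Sum>n<N. (cmod (fps_nth (B * u) n))\<^sup>2)"
      by (simp add: sum.distrib sum_distrib_left)
    also have "\<dots> \<le> 4 * l2sq u"
      using sum_le_l2sq[OF assms, of N] sum_le_l2sq[OF B_contraction(1)[OF assms], of N]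
        B_contraction(2)[OF assms] by simp
    finally show ?thesis .
  qed
  then show ?thesis
    by (rule l2I_bounded(2))
qed

end

section \<open>Poisson integrals of singular measures\<close>

definition unit_exp :: "real \<Rightarrow> complex" where "unit_exp x = cis (2 * pi * x)"

lemma norm_unit_exp [simp]: "cmod (unit_exp x) = 1"
  by (simp add: unit_exp_def)

lemma unit_exp_diff: "unit_exp (x - y) = unit_exp x * cnj (unit_exp y)"
  by (simp add: unit_exp_def cis_cnj cis_mult algebra_simps)

lemma unit_exp_power: "unit_exp x ^ n = unit_exp (real n * x)"
  by (simp add: unit_exp_def Complex.DeMoivre mult.left_commute)

lemma continuous_unit_exp [continuous_intros]:
  "continuous_on S f \<Longrightarrow> continuous_on S (\<lambda>x. unit_exp (f x))"
  unfolding unit_exp_def by (intro continuous_intros)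

lemma measurable_unit_exp [measurable]: "unit_exp \<in> borel_measurable borel"
  by (intro borel_measurable_continuous_onI continuous_intros)

lemma measurable_cnj_unit_exp [measurable]: "(\<lambda>t. cnj (unit_exp t)) \<in> borel_measurable borel"
  by (intro borel_measurable_continuous_onI continuous_intros)

lemma unit_exp_eq_1: "unit_exp x = 1 \<longleftrightarrow> x \<in> \<int>"
proof -
  have "unit_exp x = exp (\<i> * of_real (2 * pi * x))"
    by (simp add: unit_exp_def cis_conv_exp)
  then have "unit_exp x = 1 \<longleftrightarrow> (\<exists>n::int. x = of_int n)"
    by (simp add: exp_eq_1)
  then show ?thesis
    by (auto elim: Ints_cases)
qed

text \<open>Kept as a measure on the whole line, so that its measurable sets are the Borel
  sets.\<close>

abbreviation unit_lborel :: "real measure" where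
  "unit_lborel \<equiv> uniform_measure lborel {0..1}"

lemma prob_unit_lborel: "prob_space unit_lborel"
  by (rule prob_space_uniform_measure) auto

lemma AE_unit_lborel: "AE x in unit_lborel. x \<in> {0..1}"
  by (rule AE_uniform_measureI) auto

lemma integral_unit_exp: "(LINT x|unit_lborel. unit_exp (of_int k * x)) = (if k = 0 then 1 else 0)"
proof (cases "k = 0")
  case True
  interpret prob_space unit_lborel
    by (rule prob_unit_lborel)
  show ?thesis
    using True prob_space by (simp add: unit_exp_def)
next
  case False
  define F where "F = (\<lambda>x. unit_exp (of_int k * x) / (2 * pi * \<i> * of_int k))"
  have "(LINT x|unit_lborel. unit_exp (of_int k * x))
      = (LINT x|lborel. indicator {0..1} x *\<^sub>R unit_exp (of_int k * x))"
  proof -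
    have "unit_lborel = density lborel (\<lambda>x. ennreal (indicator {0..1} x))"
      by (auto simp: uniform_measure_def intro!: arg_cong[where f = "density lborel"] split: split_indicator)
    then show ?thesis
      by (simp add: integral_density)
  qed
  also have "\<dots> = F 1 - F 0"
  proof (rule integral_FTC_Icc)
    fix x :: real
    have "((\<lambda>z. exp (2 * pi * \<i> * of_int k * z) / (2 * pi * \<i> * of_int k))
        has_field_derivative exp (2 * pi * \<i> * of_int k * of_real x)) (at (of_real x))"
      by (rule derivative_eq_intros refl | simp add: False)+
    then have "((\<lambda>x. exp (2 * pi * \<i> * of_int k * of_real x) / (2 * pi * \<i> * of_int k))
        has_vector_derivative exp (2 * pi * \<i> * of_int k * of_real x)) (at x within {0..1})"
      by (rule has_vector_derivative_real_field)
    then show "(F has_vector_derivative unit_exp (of_int k * x)) (at x within {0..1})"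
      by (simp add: F_def unit_exp_def cis_conv_exp mult_ac)
    show "continuous_on {0..1} (\<lambda>x. unit_exp (of_int k * x))"
      by (intro continuous_intros)
  qed simp
  also have "\<dots> = 0"
    using unit_exp_eq_1[of "of_int k"] unit_exp_eq_1[of 0] by (simp add: F_def)
  finally show ?thesis
    using False by simp
qed

lemma parseval_finite:
  "(LINT x|unit_lborel. (cmod (\<Sum>n<N. d n * unit_exp (real n * x)))\<^sup>2) = (\<Sum>n<N. (cmod (d n))\<^sup>2)"
proof -
  interpret prob_space unit_lborel
    by (rule prob_unit_lborel)
  have int: "integrable unit_lborel (\<lambda>x. c * unit_exp (of_int k * x))" for c k
    by (rule integrable_const_bound[of _ "cmod c"]) (simp_all add: norm_mult)
  have "of_real ((cmod (\<Sum>n<N. d n * unit_exp (real n * x)))\<^sup>2)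
      = (\<Sum>n<N. \<Sum>m<N. d n * cnj (d m) * unit_exp (of_int (int n - int m) * x))" for x
    unfolding complex_norm_square cnj_sum sum_product
    by (intro sum.cong refl) (simp add: unit_exp_diff left_diff_distrib mult.assoc mult.left_commute[of "unit_exp _"])
  then have "complex_of_real (LINT x|unit_lborel. (cmod (\<Sum>n<N. d n * unit_exp (real n * x)))\<^sup>2)
      = (LINT x|unit_lborel. (\<Sum>n<N. \<Sum>m<N. d n * cnj (d m) * unit_exp (of_int (int n - int m) * x)))"
    by (simp only: integral_complex_of_real[symmetric])
  also have "\<dots> = (\<Sum>n<N. \<Sum>m<N. d n * cnj (d m) * (if int n - int m = 0 then 1 else 0))"
    by (subst Bochner_Integration.integral_sum, intro Bochner_Integration.integrable_sum int,
      subst Bochner_Integration.integral_sum, rule int)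
      (simp only: integral_mult_right_zero integral_unit_exp)
  also have "\<dots> = (\<Sum>n<N. \<Sum>m<N. if n = m then d n * cnj (d m) else 0)"
    by (intro sum.cong refl) simp
  also have "\<dots> = complex_of_real (\<Sum>n<N. (cmod (d n))\<^sup>2)"
    by (simp add: complex_norm_square del: of_real_power)
  finally show ?thesis
    by (subst (asm) of_real_eq_iff)
qed

text \<open>Absolute summability gives a constant dominating function for the finite case. It is
  available on circles of radius below 1, where powers of r damp the coefficients.\<close>

lemma parseval:
  assumes "summable (\<lambda>n. cmod (d n))"
  shows "(LINT x|unit_lborel. (cmod (\<Sum>n. d n * unit_exp (real n * x)))\<^sup>2) = (\<Sum>n. (cmod (d n))\<^sup>2)"
    and "summable (\<lambda>n. (cmod (d n))\<^sup>2)"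
    and "integrable unit_lborel (\<lambda>x. (cmod (\<Sum>n. d n * unit_exp (real n * x)))\<^sup>2)"
proof -
  interpret prob_space unit_lborel
    by (rule prob_unit_lborel)
  define f where "f N x = (cmod (\<Sum>n<N. d n * unit_exp (real n * x)))\<^sup>2" for N x
  define g where "g x = (cmod (\<Sum>n. d n * unit_exp (real n * x)))\<^sup>2" for x
  have lim: "(\<lambda>N. f N x) \<longlonglongrightarrow> g x" for x
    unfolding f_def g_def
    by (intro tendsto_intros summable_LIMSEQ summable_norm_cancel[of "\<lambda>n. d n * unit_exp (real n * x)"])
       (simp add: norm_mult assms)
  have [measurable]: "f N \<in> borel_measurable unit_lborel" for N
    unfolding f_def by measurable
  have [measurable]: "g \<in> borel_measurable unit_lborel"
    by (rule borel_measurable_LIMSEQ_real[OF lim]) measurable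
  have bound: "norm (f N x) \<le> (\<Sum>n. cmod (d n))\<^sup>2" for N x
  proof -
    have "cmod (\<Sum>n<N. d n * unit_exp (real n * x)) \<le> (\<Sum>n<N. cmod (d n))"
      by (rule order_trans[OF norm_sum]) (simp add: norm_mult)
    also have "\<dots> \<le> (\<Sum>n. cmod (d n))"
      by (rule sum_le_suminf[OF assms]) auto
    finally show ?thesis
      by (simp add: f_def power_mono)
  qed
  have "(\<lambda>N. LINT x|unit_lborel. f N x) \<longlonglongrightarrow> (LINT x|unit_lborel. g x)"
    by (rule integral_dominated_convergence[where w = "\<lambda>_. (\<Sum>n. cmod (d n))\<^sup>2"])
       (use lim bound in simp_all)
  then have "(\<lambda>n. (cmod (d n))\<^sup>2) sums (LINT x|unit_lborel. g x)"
    unfolding f_def parseval_finite sums_def .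
  then show "(LINT x|unit_lborel. (cmod (\<Sum>n. d n * unit_exp (real n * x)))\<^sup>2) = (\<Sum>n. (cmod (d n))\<^sup>2)"
    and "summable (\<lambda>n. (cmod (d n))\<^sup>2)"
    by (auto simp: g_def sums_iff)
  show "integrable unit_lborel (\<lambda>x. (cmod (\<Sum>n. d n * unit_exp (real n * x)))\<^sup>2)"
    unfolding g_def[symmetric]
    by (rule integrable_dominated_convergence[where w = "\<lambda>_. (\<Sum>n. cmod (d n))\<^sup>2" and s = f])
       (use lim bound in simp_all)
qed

definition poisson :: "real \<Rightarrow> real \<Rightarrow> real" where
  "poisson r y = (1 - r\<^sup>2) / (cmod (1 - of_real r * unit_exp y))\<^sup>2"

lemma poisson_nonneg: "0 \<le> r \<Longrightarrow> r < 1 \<Longrightarrow> 0 \<le> poisson r y"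
  by (simp add: poisson_def power_le_one)

lemma measurable_poisson [measurable]: "poisson r \<in> borel_measurable borel"
  unfolding poisson_def by measurable

text \<open>The kernel is \<open>1 - r\<^sup>2\<close> times the squared modulus of a geometric
  series, so Parseval reduces the mean to the sum of \<open>r\<^sup>2\<^sup>n\<close>.\<close>

lemma nn_integral_poisson:
  assumes r: "0 \<le> r" "r < 1"
  shows "(\<integral>\<^sup>+x. ennreal (poisson r (x - t)) \<partial>unit_lborel) = 1"
proof -
  define d where "d n = (of_real r * cnj (unit_exp t)) ^ n" for n
  have d: "cmod (d n) = r ^ n" for n
    using r by (simp add: d_def norm_power norm_mult)
  have s: "summable (\<lambda>n. cmod (d n))"
    unfolding d using r by (simp add: summable_geometric)
  have "(\<Sum>n. d n * unit_exp (real n * x)) = 1 / (1 - of_real r * unit_exp (x - t))" for x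
  proof -
    have "d n * unit_exp (real n * x) = (of_real r * unit_exp (x - t)) ^ n" for n
      by (simp add: d_def unit_exp_diff power_mult_distrib mult.assoc mult.left_commute[of "unit_exp x ^ n"]
          flip: unit_exp_power)
    then show ?thesis
      using r by (simp add: suminf_geometric norm_mult)
  qed
  then have eq: "poisson r (x - t) = (1 - r\<^sup>2) * (cmod (\<Sum>n. d n * unit_exp (real n * x)))\<^sup>2" for x
    by (simp add: poisson_def norm_divide power_divide)
  have "(\<Sum>n. (cmod (d n))\<^sup>2) = (\<Sum>n. (r\<^sup>2) ^ n)"
    unfolding d by (simp add: power_mult[symmetric] mult.commute)
  also have "\<dots> = 1 / (1 - r\<^sup>2)"
    using r by (intro suminf_geometric) (simp add: power_less_one_iff abs_square_less_1)
  finally have sq: "(\<Sum>n. (cmod (d n))\<^sup>2) = 1 / (1 - r\<^sup>2)" .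
  have "r\<^sup>2 \<noteq> 1"
    using r by (simp add: power2_eq_1_iff)
  then have "(LINT x|unit_lborel. poisson r (x - t)) = 1"
    unfolding eq integral_mult_right_zero parseval(1)[OF s] sq by simp
  moreover have "integrable unit_lborel (\<lambda>x. poisson r (x - t))"
    unfolding eq by (intro integrable_mult_right parseval(3) s)
  ultimately show ?thesis
    using nn_integral_eq_integral[of unit_lborel "\<lambda>x. poisson r (x - t)"] poisson_nonneg[OF r]
    by simp
qed

text \<open>Moving from radius 1 to r changes the denominator by at most 1 - r, hence its modulus
  stays above \<delta>/2.\<close>

lemma poisson_le:
  assumes r: "0 \<le> r" "r < 1" and \<delta>: "0 < \<delta>" "\<delta> \<le> cmod (1 - unit_exp y)" and "1 - r \<le> \<delta> / 2"
  shows "poisson r y \<le> 8 * (1 - r) / \<delta>\<^sup>2"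
proof -
  have "cmod (1 - unit_exp y) \<le> cmod (1 - of_real r * unit_exp y) + cmod (of_real (1 - r) * unit_exp y)"
    using norm_triangle_ineq4[of "1 - of_real r * unit_exp y" "of_real (1 - r) * unit_exp y"]
    by (simp add: algebra_simps)
  also have "cmod (of_real (1 - r) * unit_exp y) = 1 - r"
    using r by (simp only: norm_mult norm_unit_exp norm_of_real) simp
  finally have "\<delta> / 2 \<le> cmod (1 - of_real r * unit_exp y)"
    using assms by linarith
  then have "(\<delta> / 2)\<^sup>2 \<le> (cmod (1 - of_real r * unit_exp y))\<^sup>2"
    using \<delta> by (intro power_mono) auto
  moreover have "(1 - r) * (1 + r) \<le> (1 - r) * 2"
    using r by (intro mult_left_mono) auto
  then have "1 - r\<^sup>2 \<le> 2 * (1 - r)"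
    by (simp add: power2_eq_square algebra_simps)
  ultimately have "poisson r y \<le> 2 * (1 - r) / (\<delta> / 2)\<^sup>2"
    unfolding poisson_def using r \<delta> by (intro frac_le) auto
  then show ?thesis
    by (simp add: power_divide)
qed

text \<open>Choose a compact C inside Z missing mass at most \<epsilon>, and an open V around Z of
  length at most \<epsilon>. The bound 1 on V costs \<epsilon>, the mass on C seen from outside V
  costs \<epsilon> for r near 1, and the mass off C costs 4\<epsilon>.\<close>

lemma nn_integral_poisson_small:
  fixes \<nu> :: "real measure" and Z :: "real set"
  assumes "prob_space \<nu>" and sets [measurable_cong]: "sets \<nu> = sets borel"
    and Z: "Z \<in> sets borel" "Z \<subseteq> {0..<1}" "emeasure lborel Z = 0" "emeasure \<nu> (- Z) = 0"
    and \<epsilon>: "0 < \<epsilon>"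
  shows "\<exists>r>0. r < 1 \<and>
    (\<integral>\<^sup>+x. min 1 (4 * (\<integral>\<^sup>+t. ennreal (poisson r (x - t)) \<partial>\<nu>)) \<partial>unit_lborel) \<le> ennreal (6 * \<epsilon>)"
proof -
  interpret \<nu>: prob_space \<nu>
    by fact
  interpret U: prob_space unit_lborel
    by (rule prob_unit_lborel)
  interpret pair_sigma_finite unit_lborel \<nu> ..
  have space: "space \<nu> = UNIV"
    using sets_eq_imp_space_eq[OF sets] by simp
  obtain C where C: "C \<subseteq> Z" "compact C" "emeasure \<nu> (- C) \<le> ennreal \<epsilon>"
  proof -
    have "emeasure \<nu> Z = 1"
    proof -
      have "emeasure \<nu> Z = emeasure \<nu> Z + emeasure \<nu> (- Z)"
        using Z by simp
      also have "\<dots> = emeasure \<nu> (Z \<union> - Z)"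
        using Z by (intro plus_emeasure) (auto simp: sets)
      finally show ?thesis
        using \<nu>.emeasure_space_1 space by simp
    qed
    moreover have "emeasure \<nu> Z = (SUP K \<in> {K. K \<subseteq> Z \<and> compact K}. emeasure \<nu> K)"
      by (rule inner_regular) (use Z sets in auto)
    moreover have "ennreal (1 - \<epsilon>) < 1"
      using \<epsilon> by (simp add: ennreal_less_one_iff)
    ultimately obtain C where C: "C \<subseteq> Z" "compact C" "ennreal (1 - \<epsilon>) < emeasure \<nu> C"
      by (metis (no_types, lifting) less_SUP_iff mem_Collect_eq)
    have mC: "C \<in> sets \<nu>"
      using C(2) by (simp add: sets borel_compact)
    have "1 - \<epsilon> \<le> measure \<nu> C"
      using C(3) by (simp add: \<nu>.emeasure_eq_measure ennreal_less_iff ennreal_le_iff2 order.strict_implies_order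
          split: if_splits) (metis ennreal_le_iff less_imp_le measure_nonneg)
    then have "measure \<nu> (- C) \<le> \<epsilon>"
      using \<nu>.prob_compl[OF mC] space by (simp add: Compl_eq_Diff_UNIV)
    then show thesis
      using C \<epsilon> by (intro that[of C]) (simp_all add: \<nu>.emeasure_eq_measure ennreal_leI)
  qed
  have [measurable]: "C \<in> sets borel"
    using C(2) by (rule borel_compact)
  obtain V where V: "open V" "insert 1 Z \<subseteq> V" "emeasure lborel V \<le> ennreal \<epsilon>"
  proof -
    \<comment> \<open>\<open>unit_exp\<close> identifies 0 and 1, so V must also cover x = 1, where
      the kernel with t = 0 is singular.\<close>
    have "insert 1 Z \<in> sets borel"
      using Z by auto
    then obtain V where V: "open V" "insert 1 Z \<subseteq> V" "emeasure lborel (V - insert 1 Z) < \<epsilon>"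
      using outer_regular_lborel[OF _ \<epsilon>] by metis
    have "emeasure lborel V \<le> emeasure lborel ((V - insert 1 Z) \<union> (insert 1 Z))"
      using V Z by (intro emeasure_mono) auto
    also have "\<dots> \<le> emeasure lborel (V - insert 1 Z) + emeasure lborel (insert 1 Z)"
      using V Z by (intro emeasure_subadditive) auto
    also have "emeasure lborel (insert 1 Z) \<le> emeasure lborel {1} + emeasure lborel Z"
      using emeasure_subadditive[of "{1}" lborel Z] Z by simp
    finally show thesis
      using V Z by (intro that[of V]) (auto dest: order.strict_implies_order order_trans)
  qed
  have [measurable]: "V \<in> sets borel"
    using V(1) by simp
  obtain \<delta> where \<delta>: "0 < \<delta>"
    and \<delta>_le: "\<And>x t. x \<in> {0..1} - V \<Longrightarrow> t \<in> C \<Longrightarrow> \<delta> \<le> cmod (1 - unit_exp (x - t))"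
  proof (cases "({0..1} - V) \<times> C = {}")
    case True
    then show thesis
      by (intro that[of 1]) (simp, blast)
  next
    case False
    have "compact (({0..1} - V) \<times> C)"
      using C(2) V(1) by (intro compact_Times compact_diff) auto
    moreover have "continuous_on (({0..1} - V) \<times> C) (\<lambda>p. cmod (1 - unit_exp (fst p - snd p)))"
      by (intro continuous_intros)
    ultimately have "\<exists>p\<in>({0..1} - V) \<times> C. \<forall>q\<in>({0..1} - V) \<times> C.
        cmod (1 - unit_exp (fst p - snd p)) \<le> cmod (1 - unit_exp (fst q - snd q))"
      using False by (intro continuous_attains_inf)
    then obtain p where p: "p \<in> ({0..1} - V) \<times> C"
      and min: "\<And>q. q \<in> ({0..1} - V) \<times> C \<Longrightarrow>
        cmod (1 - unit_exp (fst p - snd p)) \<le> cmod (1 - unit_exp (fst q - snd q))"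
      by blast
    \<comment> \<open>The difference lies in (-1, 1]. The value 0 is excluded by Z \<subseteq> V and
      the value 1 by 1 being in V, so the minimum over the compact product is positive.\<close>
    have "fst p - snd p \<notin> \<int>"
    proof
      assume "fst p - snd p \<in> \<int>"
      then obtain k where k: "fst p - snd p = of_int k"
        by (elim Ints_cases)
      have "fst p \<in> {0..1}" "fst p \<notin> V" "snd p \<in> {0..<1}" "snd p \<in> V"
        using p C(1) Z(2) V(2) by auto
      then have "-1 < (of_int k :: real)" "(of_int k :: real) \<le> 1"
        using k by auto
      then have "k = 0 \<or> k = 1"
        by linarith
      then show False
      proof
        assume "k = 0"
        then show False
          using k \<open>fst p \<notin> V\<close> \<open>snd p \<in> V\<close> by simp
      next
        assume "k = 1"
        then have "fst p = 1"
          using k \<open>fst p \<in> {0..1}\<close> \<open>snd p \<in> {0..<1}\<close> by simp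
        then show False
          using V(2) \<open>fst p \<notin> V\<close> by simp
      qed
    qed
    then have "0 < cmod (1 - unit_exp (fst p - snd p))"
      using unit_exp_eq_1[of "fst p - snd p"] by auto
    then show thesis
      by (rule that) (use min[of "(_, _)"] in auto)
  qed
  \<comment> \<open>The three bounds serve r > 0, the hypothesis of \<open>poisson_le\<close>, and a
    kernel of at most \<epsilon>/4 on C.\<close>
  define h where "h = min (1 / 2) (min (\<delta> / 2) (\<epsilon> * \<delta>\<^sup>2 / 32))"
  have h: "0 < h" "h \<le> 1 / 2" "h \<le> \<delta> / 2" "h \<le> \<epsilon> * \<delta>\<^sup>2 / 32"
    using \<delta> \<epsilon> by (auto simp: h_def)
  define r where "r = 1 - h"
  have r: "0 < r" "0 \<le> r" "r < 1"
    using h by (auto simp: r_def)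
  let ?P = "\<lambda>x t. ennreal (poisson r (x - t))"
  have near: "(\<integral>\<^sup>+t. ?P x t * indicator C t \<partial>\<nu>) \<le> ennreal (\<epsilon> / 4)" if x: "x \<in> {0..1} - V" for x
  proof -
    have "poisson r (x - t) \<le> \<epsilon> / 4" if "t \<in> C" for t
    proof -
      have "poisson r (x - t) \<le> 8 * (1 - r) / \<delta>\<^sup>2"
        using \<delta> r \<delta>_le[OF x that] h by (intro poisson_le) (auto simp: r_def)
      also have "\<dots> \<le> \<epsilon> / 4"
        using h(4) \<delta> by (simp add: r_def field_simps)
      finally show ?thesis .
    qed
    then have "(\<integral>\<^sup>+t. ?P x t * indicator C t \<partial>\<nu>) \<le> (\<integral>\<^sup>+t. ennreal (\<epsilon> / 4) \<partial>\<nu>)"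
      by (intro nn_integral_mono) (auto split: split_indicator intro!: ennreal_leI)
    then show ?thesis
      by (simp add: \<nu>.emeasure_space_1)
  qed
  define Q where "Q x = (\<integral>\<^sup>+t. ?P x t * indicator (- C) t \<partial>\<nu>)" for x
  have [measurable]: "Q \<in> borel_measurable unit_lborel"
    unfolding Q_def by measurable
  have "min 1 (4 * (\<integral>\<^sup>+t. ?P x t \<partial>\<nu>)) \<le> indicator V x + ennreal \<epsilon> + 4 * Q x" if "x \<in> {0..1}" for x
  proof (cases "x \<in> V")
    case True
    then show ?thesis
      by (simp add: min.coboundedI1 add.assoc)
  next
    case False
    have "(\<integral>\<^sup>+t. ?P x t \<partial>\<nu>) = (\<integral>\<^sup>+t. ?P x t * indicator C t + ?P x t * indicator (- C) t \<partial>\<nu>)"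
      by (intro nn_integral_cong) (simp split: split_indicator)
    also have "\<dots> = (\<integral>\<^sup>+t. ?P x t * indicator C t \<partial>\<nu>) + Q x"
      unfolding Q_def by (intro nn_integral_add) measurable
    also have "\<dots> \<le> ennreal (\<epsilon> / 4) + Q x"
      by (intro add_right_mono near) (use that False in simp)
    finally have "4 * (\<integral>\<^sup>+t. ?P x t \<partial>\<nu>) \<le> 4 * (ennreal (\<epsilon> / 4) + Q x)"
      by (rule mult_left_mono) simp
    also have "\<dots> = ennreal \<epsilon> + 4 * Q x"
      using \<epsilon> ennreal_mult[of 4 "\<epsilon> / 4"] by (simp add: distrib_left)
    finally show ?thesis
      using False by (simp add: min.coboundedI2)
  qed
  then have "AE x in unit_lborel. min 1 (4 * (\<integral>\<^sup>+t. ?P x t \<partial>\<nu>)) \<le> indicator V x + ennreal \<epsilon> + 4 * Q x"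
    using AE_unit_lborel by (auto elim: eventually_mono)
  then have "(\<integral>\<^sup>+x. min 1 (4 * (\<integral>\<^sup>+t. ?P x t \<partial>\<nu>)) \<partial>unit_lborel)
      \<le> (\<integral>\<^sup>+x. indicator V x + ennreal \<epsilon> + 4 * Q x \<partial>unit_lborel)"
    by (rule nn_integral_mono_AE)
  also have "\<dots> = emeasure unit_lborel V + ennreal \<epsilon> + 4 * (\<integral>\<^sup>+x. Q x \<partial>unit_lborel)"
    by (simp add: nn_integral_add nn_integral_cmult U.emeasure_space_1)
  also have "emeasure unit_lborel V \<le> ennreal \<epsilon>"
  proof -
    have "emeasure unit_lborel V = emeasure lborel ({0..1} \<inter> V)"
      by (simp add: divide_ennreal_def)
    also have "\<dots> \<le> emeasure lborel V"
      by (intro emeasure_mono) auto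
    finally show ?thesis
      using V(3) by order
  qed
  \<comment> \<open>By Tonelli: each kernel has mean 1 in x, leaving just the mass of \<nu> off
    C.\<close>
  also have "(\<integral>\<^sup>+x. Q x \<partial>unit_lborel)
      = (\<integral>\<^sup>+t. (\<integral>\<^sup>+x. ?P x t * indicator (- C) t \<partial>unit_lborel) \<partial>\<nu>)"
    unfolding Q_def by (rule Fubini'[symmetric]) measurable
  also have "\<dots> = (\<integral>\<^sup>+t. indicator (- C) t \<partial>\<nu>)"
    by (intro nn_integral_cong)
      (simp add: nn_integral_multc nn_integral_poisson[OF r(2,3)])
  also have "\<dots> \<le> ennreal \<epsilon>"
    using C(3) by (subst nn_integral_indicator) (simp_all add: sets)
  finally have "(\<integral>\<^sup>+x. min 1 (4 * (\<integral>\<^sup>+t. ?P x t \<partial>\<nu>)) \<partial>unit_lborel)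
      \<le> ennreal \<epsilon> + ennreal \<epsilon> + 4 * ennreal \<epsilon>"
    by (simp add: add_mono mult_left_mono)
  also have "\<dots> = ennreal (\<epsilon> + \<epsilon> + 4 * \<epsilon>)"
    using \<epsilon> ennreal_mult[of 4 \<epsilon>] by (simp only: ennreal_plus ennreal_numeral)
  also have "\<epsilon> + \<epsilon> + 4 * \<epsilon> = 6 * \<epsilon>"
    by simp
  finally show ?thesis
    using r by blast
qed

text \<open>The left side is the real part of the Herglotz kernel (1 + w)/(1 - w).\<close>

lemma Re_inverse_one_minus:
  assumes "cmod w < 1"
  shows "2 * Re (1 / (1 - w)) - 1 = (1 - (cmod w)\<^sup>2) / (cmod (1 - w))\<^sup>2"
proof -
  have "1 - w \<noteq> 0"
    using assms by auto
  then have "(cmod (1 - w))\<^sup>2 \<noteq> 0"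
    by simp
  moreover have "Re (1 / (1 - w)) = (1 - Re w) / (cmod (1 - w))\<^sup>2"
    by (simp add: Re_divide cmod_power2)
  ultimately show ?thesis
    by (simp add: field_simps cmod_power2) (simp add: power2_eq_square algebra_simps)
qed

text \<open>Here m stands for a value of \<open>mu_plus\<close>, and 1 - 1/m for that of b.
  Expanding \<open>|m - 1|\<^sup>2\<close> gives
  \<open>1 - |b|\<^sup>2 = (2 Re m - 1) / |m|\<^sup>2\<close>; the factor 4 comes from |m| \<ge>
  1/2.\<close>

lemma one_minus_norm_square:
  assumes "1 \<le> 2 * Re m"
  shows "0 \<le> 1 - (cmod (1 - 1 / m))\<^sup>2" and "1 - (cmod (1 - 1 / m))\<^sup>2 \<le> 4 * (2 * Re m - 1)"
proof -
  have "m \<noteq> 0"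
    using assms by auto
  then have "1 - 1 / m = (m - 1) / m"
    by (simp add: field_simps)
  then have eq: "1 - (cmod (1 - 1 / m))\<^sup>2 = (2 * Re m - 1) / (cmod m)\<^sup>2"
  proof -
    have "(cmod (m - 1))\<^sup>2 = (cmod m)\<^sup>2 - (2 * Re m - 1)"
      by (simp add: cmod_power2 power2_diff)
    then show ?thesis
      unfolding \<open>1 - 1 / m = (m - 1) / m\<close> norm_divide power_divide using \<open>m \<noteq> 0\<close>
      by (simp add: diff_divide_distrib)
  qed
  show "0 \<le> 1 - (cmod (1 - 1 / m))\<^sup>2"
    unfolding eq using assms by simp
  have "1 / 2 \<le> cmod m"
    using assms complex_Re_le_cmod[of m] by linarith
  then have "(1 / 2)\<^sup>2 \<le> (cmod m)\<^sup>2"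
    by (intro power_mono) auto
  then have "(2 * Re m - 1) / (cmod m)\<^sup>2 \<le> (2 * Re m - 1) / (1 / 2)\<^sup>2"
    using assms by (intro divide_left_mono) (auto simp: \<open>m \<noteq> 0\<close>)
  then show "1 - (cmod (1 - 1 / m))\<^sup>2 \<le> 4 * (2 * Re m - 1)"
    unfolding eq by (simp add: power2_eq_square)
qed

section \<open>Power series on the disc\<close>

definition disc_series :: "complex fps \<Rightarrow> (complex \<Rightarrow> complex) \<Rightarrow> bool" where
  "disc_series F f \<longleftrightarrow> fps_conv_radius F \<ge> 1 \<and> (\<forall>z\<in>ball 0 1. eval_fps F z = f z)"

lemma disc_seriesI:
  assumes "\<And>z. z \<in> ball 0 1 \<Longrightarrow> (\<lambda>n. fps_nth F n * z ^ n) sums f z"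
  shows "disc_series F f"
proof -
  have "fps_conv_radius F \<ge> 1"
    unfolding fps_conv_radius_def
  proof (rule conv_radius_geI_ex')
    fix r :: real assume "0 < r" "ereal r < 1"
    then show "summable (\<lambda>n. fps_nth F n * of_real r ^ n)"
      using assms[of "of_real r"] by (auto simp: sums_iff)
  qed
  then show ?thesis
    using assms by (auto simp: disc_series_def eval_fps_def sums_iff)
qed

lemma norm_less_fps_conv_radius: "z \<in> ball 0 1 \<Longrightarrow> fps_conv_radius F \<ge> 1 \<Longrightarrow> ereal (norm z) < fps_conv_radius F"
  for z :: complex
  by (rule less_le_trans[of _ 1]) auto

lemma disc_series_mult:
  assumes "disc_series F f" "disc_series G g"
  shows "disc_series (F * G) (\<lambda>z. f z * g z)"
  using assms unfolding disc_series_def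
  by (auto simp: eval_fps_mult norm_less_fps_conv_radius intro: order_trans[OF _ fps_conv_radius_mult])

lemma disc_series_one: "disc_series 1 (\<lambda>z. 1)"
  by (simp add: disc_series_def)

lemma disc_series_power: "disc_series F f \<Longrightarrow> disc_series (F ^ K) (\<lambda>z. f z ^ K)"
  by (induction K) (simp_all add: disc_series_one disc_series_mult)

lemma disc_series_one_minus:
  assumes "disc_series F f"
  shows "disc_series (1 - F) (\<lambda>z. 1 - f z)"
  using assms unfolding disc_series_def
  by (auto simp: eval_fps_diff norm_less_fps_conv_radius intro: order_trans[OF _ fps_conv_radius_diff])

lemma disc_series_cong:
  "disc_series F f \<Longrightarrow> (\<And>z. z \<in> ball 0 1 \<Longrightarrow> f z = g z) \<Longrightarrow> disc_series F g"
  by (simp add: disc_series_def)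

lemma disc_series_has_fps_expansion:
  assumes "disc_series F f"
  shows "f has_fps_expansion F"
proof -
  have "0 < fps_conv_radius F"
    using assms less_le_trans[of 0 "1::ereal"] by (auto simp: disc_series_def)
  moreover have "eventually (\<lambda>z. eval_fps F z = f z) (nhds 0)"
    using assms by (intro eventually_nhds_in_open[of "ball 0 1", THEN eventually_mono])
      (auto simp: disc_series_def)
  ultimately show ?thesis
    by (simp add: has_fps_expansion_def)
qed

lemma disc_series_unique:
  assumes "disc_series F f" "disc_series G f"
  shows "F = G"
  using fps_expansion_eqI[OF disc_series_has_fps_expansion[OF assms(1)]]
    fps_expansion_eqI[OF disc_series_has_fps_expansion[OF assms(2)]] by simp

lemma taylor_coeff_disc_series: "disc_series F f \<Longrightarrow> taylor_coeff f n = fps_nth F n"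
  using fps_expansion_eqI[OF disc_series_has_fps_expansion] by (simp add: taylor_coeff_def)

lemma disc_series_in_hardy2:
  assumes "disc_series F f"
  shows "f \<in> hardy2 \<longleftrightarrow> l2 F"
proof -
  have "f holomorphic_on ball 0 1"
  proof (rule holomorphic_transform)
    show "eval_fps F holomorphic_on ball 0 1"
      using assms by (intro holomorphic_intros) (auto simp: disc_series_def norm_less_fps_conv_radius)
  qed (use assms in \<open>auto simp: disc_series_def\<close>)
  then show ?thesis
    by (simp add: hardy2_def l2_def taylor_coeff_disc_series[OF assms])
qed

lemma disc_series_of_l2:
  assumes "l2 u"
  shows "disc_series u (eval_fps u)"
proof -
  have "fps_conv_radius u \<ge> 1"
    unfolding fps_conv_radius_def
  proof (rule conv_radius_geI_ex')
    fix r :: real assume r: "0 < r" "ereal r < 1"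
    show "summable (\<lambda>n. fps_nth u n * of_real r ^ n)"
    proof (rule summable_comparison_test'[where N = 0])
      show "summable (\<lambda>n. (1 + l2sq u) * r ^ n)"
        using r by (intro summable_mult summable_geometric) simp
      show "norm (fps_nth u n * of_real r ^ n) \<le> (1 + l2sq u) * r ^ n" for n
      proof -
        \<comment> \<open>Any bound on the coefficients gives radius of convergence at least 1; this
          one avoids square roots.\<close>
        have "2 * cmod (fps_nth u n) \<le> 1 + (cmod (fps_nth u n))\<^sup>2"
          using sum_squares_bound[of 1 "cmod (fps_nth u n)"] by simp
        then have "cmod (fps_nth u n) \<le> 1 + l2sq u"
          using norm_nth_le_l2sq[OF assms, of n] l2sq_nonneg[OF assms] by linarith
        then show ?thesis
          using r by (simp add: norm_mult norm_power mult_right_mono)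
      qed
    qed
  qed
  then show ?thesis
    by (simp add: disc_series_def)
qed

section \<open>Cauchy integrals and the inner function\<close>

text \<open>The spectral measure is moved from [0, 1) to the whole line, so that measurability
  refers to plain Borel sets.\<close>

locale circle_measure = prob_space \<nu> for \<nu> :: "real measure" +
  assumes sets_\<nu> [measurable_cong]: "sets \<nu> = sets borel"
begin

definition moment :: "nat \<Rightarrow> complex" where
  "moment n = (LINT t|\<nu>. cnj (unit_exp t) ^ n)"

definition cauchy :: "complex \<Rightarrow> complex" where
  "cauchy z = (LINT t|\<nu>. 1 / (1 - z * cnj (unit_exp t)))"

lemma moment_sums:
  assumes "z \<in> ball 0 1"
  shows "(\<lambda>n. moment n * z ^ n) sums cauchy z"
proof -
  have z: "cmod z < 1"
    using assms by simp
  have int: "integrable \<nu> (\<lambda>t. (z * cnj (unit_exp t)) ^ n)" for n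
  proof (rule integrable_const_bound[of _ "cmod z ^ n"])
    show "AE t in \<nu>. cmod ((z * cnj (unit_exp t)) ^ n) \<le> cmod z ^ n"
      by (simp add: norm_mult norm_power)
  qed measurable
  have "(\<lambda>n. LINT t|\<nu>. (z * cnj (unit_exp t)) ^ n) sums (LINT t|\<nu>. (\<Sum>n. (z * cnj (unit_exp t)) ^ n))"
    by (rule sums_integral[OF int])
      (use z in \<open>simp_all add: norm_mult norm_power summable_geometric prob_space\<close>)
  moreover have "(\<Sum>n. (z * cnj (unit_exp t)) ^ n) = 1 / (1 - z * cnj (unit_exp t))" for t
    by (rule suminf_geometric) (use z in \<open>simp add: norm_mult\<close>)
  moreover have "(LINT t|\<nu>. (z * cnj (unit_exp t)) ^ n) = moment n * z ^ n" for n
    by (simp add: moment_def power_mult_distrib mult.commute)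
  ultimately show ?thesis
    by (simp add: cauchy_def)
qed

lemma integrable_kernel:
  assumes "cmod z < 1"
  shows "integrable \<nu> (\<lambda>t. 1 / (1 - z * cnj (unit_exp t)))"
proof (rule integrable_const_bound[of _ "1 / (1 - cmod z)"])
  have "cmod (1 / (1 - z * cnj (unit_exp t))) \<le> 1 / (1 - cmod z)" for t
  proof -
    have "1 - cmod z \<le> cmod (1 - z * cnj (unit_exp t))"
      using norm_triangle_ineq2[of 1 "z * cnj (unit_exp t)"] by (simp add: norm_mult)
    then show ?thesis
      using assms by (simp add: norm_divide frac_le)
  qed
  then show "AE t in \<nu>. cmod (1 / (1 - z * cnj (unit_exp t))) \<le> 1 / (1 - cmod z)"
    by simp
qed measurable

lemma Re_cauchy:
  assumes "cmod z < 1"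
  shows "2 * Re (cauchy z) - 1 = (LINT t|\<nu>. (1 - (cmod z)\<^sup>2) / (cmod (1 - z * cnj (unit_exp t)))\<^sup>2)"
    and "integrable \<nu> (\<lambda>t. (1 - (cmod z)\<^sup>2) / (cmod (1 - z * cnj (unit_exp t)))\<^sup>2)"
proof -
  have eq: "(1 - (cmod z)\<^sup>2) / (cmod (1 - z * cnj (unit_exp t)))\<^sup>2
      = 2 * Re (1 / (1 - z * cnj (unit_exp t))) - 1" for t
    using Re_inverse_one_minus[of "z * cnj (unit_exp t)"] assms by (simp add: norm_mult)
  note int = integrable_Re[OF integrable_kernel[OF assms]]
  show "integrable \<nu> (\<lambda>t. (1 - (cmod z)\<^sup>2) / (cmod (1 - z * cnj (unit_exp t)))\<^sup>2)"
    unfolding eq using int by (intro Bochner_Integration.integrable_diff integrable_mult_right) auto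
  have "Re (cauchy z) = (LINT t|\<nu>. Re (1 / (1 - z * cnj (unit_exp t))))"
    unfolding cauchy_def by (rule integral_Re[OF integrable_kernel[OF assms], symmetric])
  then show "2 * Re (cauchy z) - 1
      = (LINT t|\<nu>. (1 - (cmod z)\<^sup>2) / (cmod (1 - z * cnj (unit_exp t)))\<^sup>2)"
    unfolding eq using int by (subst Bochner_Integration.integral_diff) (auto simp: prob_space)
qed

lemma Re_cauchy_ge:
  assumes "cmod z < 1"
  shows "1 \<le> 2 * Re (cauchy z)"
proof -
  have "0 \<le> (LINT t|\<nu>. (1 - (cmod z)\<^sup>2) / (cmod (1 - z * cnj (unit_exp t)))\<^sup>2)"
    using assms by (intro integral_nonneg_AE) (simp add: power_le_one)
  then show ?thesis
    using Re_cauchy(1)[OF assms] by simp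
qed

lemma cauchy_nonzero: "cmod z < 1 \<Longrightarrow> cauchy z \<noteq> 0"
  using Re_cauchy_ge[of z] by auto

text \<open>On the circle of radius r the mean of \<open>|b|\<^sup>2\<close> is at most
  \<open>l2sq B\<close> by Parseval, and at least 1 - e for a suitable r by the Poisson
  estimate.\<close>

lemma inner_unimodular_mean:
  assumes Z: "Z \<in> sets borel" "Z \<subseteq> {0..<1}" "emeasure lborel Z = 0" "emeasure \<nu> (- Z) = 0"
    and B: "disc_series B (\<lambda>z. 1 - 1 / cauchy z)" and "l2 B"
  shows "1 \<le> l2sq B"
proof (rule field_le_epsilon)
  fix e :: real assume "0 < e"
  then obtain r where r: "0 < r" "r < 1" and small: "(\<integral>\<^sup>+x. min 1 (4 * (\<integral>\<^sup>+t. ennreal (poisson r (x - t)) \<partial>\<nu>)) \<partial>unit_lborel) \<le> ennreal (6 * (e / 6))"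
    using nn_integral_poisson_small[OF prob_space_axioms sets_\<nu> Z, of "e / 6"] by auto
  interpret U: prob_space unit_lborel
    by (rule prob_unit_lborel)
  define z where "z x = of_real r * unit_exp x" for x
  have z: "cmod (z x) = r" for x
    using r by (simp add: z_def norm_mult)
  define d where "d n = fps_nth B n * of_real r ^ n" for n
  have "ereal (norm (complex_of_real r)) < fps_conv_radius B"
    using B r by (intro norm_less_fps_conv_radius) (auto simp: disc_series_def)
  then have s: "summable (\<lambda>n. cmod (d n))"
    unfolding d_def fps_conv_radius_def by (rule abs_summable_in_conv_radius)
  define h where "h x = (cmod (1 - 1 / cauchy (z x)))\<^sup>2" for x
  have h_eq: "h x = (cmod (\<Sum>n. d n * unit_exp (real n * x)))\<^sup>2" for x
  proof -
    have "1 - 1 / cauchy (z x) = eval_fps B (z x)"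
      using B r z[of x] by (auto simp: disc_series_def)
    also have "\<dots> = (\<Sum>n. d n * unit_exp (real n * x))"
      unfolding eval_fps_def
      by (intro suminf_cong) (simp add: d_def z_def power_mult_distrib mult.assoc flip: unit_exp_power)
    finally show ?thesis
      by (simp add: h_def)
  qed
  have h_bounds: "0 \<le> 1 - h x" "1 - h x \<le> 4 * (2 * Re (cauchy (z x)) - 1)" for x
    using one_minus_norm_square[OF Re_cauchy_ge[of "z x"]] z[of x] r by (simp_all add: h_def)
  have "ennreal (1 - h x) \<le> min 1 (4 * (\<integral>\<^sup>+t. ennreal (poisson r (x - t)) \<partial>\<nu>))" for x
  proof -
    have P: "(1 - r\<^sup>2) / (cmod (1 - z x * cnj (unit_exp t)))\<^sup>2 = poisson r (x - t)" for t
    proof -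
      have "z x * cnj (unit_exp t) = of_real r * unit_exp (x - t)"
        by (simp add: z_def unit_exp_diff mult.assoc)
      then show ?thesis
        by (simp add: poisson_def)
    qed
    have "integrable \<nu> (\<lambda>t. poisson r (x - t))"
      and "2 * Re (cauchy (z x)) - 1 = (LINT t|\<nu>. poisson r (x - t))"
      using Re_cauchy[of "z x"] r unfolding P z by auto
    then have "(\<integral>\<^sup>+t. ennreal (poisson r (x - t)) \<partial>\<nu>) = ennreal (2 * Re (cauchy (z x)) - 1)"
      using r by (subst nn_integral_eq_integral) (auto simp: poisson_nonneg)
    moreover have "ennreal (1 - h x) \<le> ennreal 4 * ennreal (2 * Re (cauchy (z x)) - 1)"
      using h_bounds[of x] by (subst ennreal_mult'[symmetric]) (auto intro: ennreal_leI)
    moreover have "ennreal (1 - h x) \<le> 1"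
      by (simp add: h_def)
    ultimately show ?thesis
      by simp
  qed
  then have "(\<integral>\<^sup>+x. ennreal (1 - h x) \<partial>unit_lborel) \<le> ennreal (6 * (e / 6))"
    by (intro order_trans[OF nn_integral_mono small])
  moreover have int: "integrable unit_lborel h"
    unfolding h_eq by (rule parseval(3)[OF s])
  then have "(\<integral>\<^sup>+x. ennreal (1 - h x) \<partial>unit_lborel) = ennreal (LINT x|unit_lborel. 1 - h x)"
    using h_bounds(1) by (intro nn_integral_eq_integral) auto
  ultimately have "(LINT x|unit_lborel. 1 - h x) \<le> e"
    using \<open>0 < e\<close> by (simp add: ennreal_le_iff)
  moreover have "(LINT x|unit_lborel. 1 - h x) = 1 - (\<Sum>n. (cmod (d n))\<^sup>2)"
    using int U.prob_space parseval(1)[OF s] by (simp add: Bochner_Integration.integral_diff flip: h_eq)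
  moreover have "(\<Sum>n. (cmod (d n))\<^sup>2) \<le> l2sq B"
    unfolding l2sq_def
  proof (rule suminf_le[OF _ parseval(2)[OF s]])
    show "(cmod (d n))\<^sup>2 \<le> (cmod (fps_nth B n))\<^sup>2" for n
      using r by (auto simp: d_def norm_mult norm_power power_le_one mult_left_le intro!: power_mono)
  qed (use \<open>l2 B\<close> in \<open>simp add: l2_def\<close>)
  ultimately show "1 \<le> l2sq B + e"
    by linarith
qed

end

section \<open>From the spectral measure to the Kaczmarz system\<close>

lemma cinner_shift:
  assumes "stationary \<phi>" and "k \<le> n"
  shows "cinner (\<phi> k) (\<phi> n) = cinner (\<phi> 0) (\<phi> (n - k))"
  using assms unfolding stationary_def by (metis add_0 le_add_diff_inverse2)

lemma spectral_circle_measure: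
  assumes "spectral_measure \<phi> \<mu>" and "singular_measure \<mu>"
  obtains \<nu> Z where "circle_measure \<nu>"
    and "\<And>n. cinner (\<phi> 0) (\<phi> n) = circle_measure.moment \<nu> n"
    and "\<And>z. mu_plus \<mu> z = circle_measure.cauchy \<nu> z"
    and "Z \<in> sets borel" "Z \<subseteq> {0..<1}" "emeasure lborel Z = 0" "emeasure \<nu> (- Z) = 0"
proof -
  from assms(1) have prob: "prob_space \<mu>" and space: "space \<mu> = {0..<1}"
    and sets: "sets \<mu> = sets (restrict_space borel {0..<1})"
    and inner: "\<And>n m. cinner (\<phi> n) (\<phi> m) =
      (LINT x|\<mu>. exp (2 * complex_of_real pi * \<i> * (of_nat n - of_nat m) * complex_of_real x))"
    by (auto simp: spectral_measure_def)
  have meas: "(\<lambda>x. x) \<in> measurable \<mu> borel"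
    by (subst measurable_cong_sets[OF sets refl]) (rule measurable_restrict_space1, simp)
  define \<nu> where "\<nu> = distr \<mu> borel (\<lambda>x. x)"
  interpret \<nu>: circle_measure \<nu>
    unfolding circle_measure_def circle_measure_axioms_def \<nu>_def
    using prob_space.prob_space_distr[OF prob meas] by simp
  have cis: "cnj (unit_exp t) = exp (- 2 * complex_of_real pi * \<i> * complex_of_real t)" for t
    unfolding unit_exp_def cis_cnj unfolding cis_conv_exp by (simp add: mult_ac)
  have "cinner (\<phi> 0) (\<phi> n) = \<nu>.moment n" for n
  proof -
    have "\<nu>.moment n = (LINT t|\<mu>. cnj (unit_exp t) ^ n)"
      unfolding \<nu>.moment_def unfolding \<nu>_def by (rule integral_distr[OF meas]) measurable
    also have "\<dots> = (LINT t|\<mu>. exp (2 * complex_of_real pi * \<i> * (of_nat 0 - of_nat n) * complex_of_real t))"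
      unfolding cis by (intro Bochner_Integration.integral_cong refl)
        (simp add: mult_ac flip: exp_of_nat_mult)
    finally show ?thesis
      by (simp only: inner)
  qed
  moreover have "mu_plus \<mu> z = \<nu>.cauchy z" for z
  proof -
    have "\<nu>.cauchy z = (LINT t|\<mu>. 1 / (1 - z * cnj (unit_exp t)))"
      unfolding \<nu>.cauchy_def unfolding \<nu>_def by (rule integral_distr[OF meas]) measurable
    then show ?thesis
      by (simp only: mu_plus_def cis)
  qed
  moreover obtain N where N: "N \<in> sets \<mu>" "emeasure \<mu> N = 0"
    "emeasure (restrict_space lborel {0..<1}) ({0..<1} - N) = 0"
    using assms(2) by (auto simp: singular_measure_def mutually_singular_def space_restrict_space)
  \<comment> \<open>N is \<mu>-null and its complement in [0, 1) is Lebesgue null, so this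
    complement carries \<mu>.\<close>
  define Z where "Z = {0..<1} - N"
  have Z: "Z \<in> sets borel"
    using N(1) unfolding Z_def sets by (auto simp: sets_restrict_space_iff)
  moreover have "emeasure lborel Z = 0"
    using N(3) Z unfolding Z_def by (subst (asm) emeasure_restrict_space) auto
  moreover have "emeasure \<nu> (- Z) = emeasure \<mu> N"
  proof -
    have "N \<subseteq> {0..<1}"
      using sets.sets_into_space[OF N(1)] space by simp
    then have "- Z \<inter> {0..<1} = N"
      by (auto simp: Z_def)
    then show ?thesis
      unfolding \<nu>_def using Z meas by (subst emeasure_distr) (auto simp: space)
  qed
  ultimately show thesis
    using \<nu>.circle_measure_axioms N(2) by (intro that[of \<nu> Z]) (auto simp: Z_def)
qed

theorem theorem2:
  fixes \<phi> :: "nat \<Rightarrow> 'a::complex_hilbert"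
    and \<mu> :: "real measure"
    and \<alpha> \<epsilon> :: "nat \<Rightarrow> complex"
    and x :: 'a
    and K :: nat
  assumes "stationary \<phi>"
    and "linearly_dense \<phi>"
    and "spectral_measure \<phi> \<mu>"
    and "singular_measure \<mu>"
    and "alpha_coeffs \<mu> \<alpha>"
    and "conv_radius \<epsilon> \<ge> 1"
    and "K \<ge> 1"
    and "(\<lambda>z. (1 - inner_fun \<mu> z) * (\<Sum>n. \<epsilon> n * z ^ n))
           \<in> hardy2_ominus (mult_hardy2 (\<lambda>z. inner_fun \<mu> z ^ K))"
  shows "summable (\<lambda>n. (\<Sum>j=0..n. \<alpha> (n - j) * cinner x (\<phi> j)) *\<^sub>C \<phi> n)
       \<and> summable (\<lambda>n. (\<Sum>j=0..n. \<alpha> (n - j) * \<epsilon> j) *\<^sub>C \<phi> n)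
       \<and> ereal (norm (\<Sum>n. (\<Sum>j=0..n. \<alpha> (n - j) * \<epsilon> j) *\<^sub>C \<phi> n))
           \<le> ereal (2 * sqrt (real K)) * l2_norm \<epsilon>"
proof -
  obtain \<nu> Z where "circle_measure \<nu>"
    and moment: "\<And>n. cinner (\<phi> 0) (\<phi> n) = circle_measure.moment \<nu> n"
    and mu_plus: "\<And>z. mu_plus \<mu> z = circle_measure.cauchy \<nu> z"
    and Z: "Z \<in> sets borel" "Z \<subseteq> {0..<1}" "emeasure lborel Z = 0" "emeasure \<nu> (- Z) = 0"
    using spectral_circle_measure[OF assms(3,4)] by blast
  interpret \<nu>: circle_measure \<nu>
    by fact
  define A a E where "A = Abs_fps \<alpha>" and "a = Abs_fps (\<lambda>n. cinner (\<phi> 0) (\<phi> n))" and "E = Abs_fps \<epsilon>"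
  have A: "disc_series A (\<lambda>z. 1 - inner_fun \<mu> z)"
    using assms(5) by (intro disc_seriesI) (simp add: alpha_coeffs_def A_def)
  have "disc_series a \<nu>.cauchy"
    using \<nu>.moment_sums by (intro disc_seriesI) (simp add: a_def moment)
  then have "disc_series (A * a) (\<lambda>z. (1 - inner_fun \<mu> z) * \<nu>.cauchy z)"
    by (rule disc_series_mult[OF A])
  then have "disc_series (A * a) (\<lambda>z. 1)"
    by (rule disc_series_cong) (simp add: inner_fun_def mu_plus \<nu>.cauchy_nonzero)
  \<comment> \<open>On the disc \<open>1 - inner_fun \<mu> z\<close> is the reciprocal of the
    nonvanishing Cauchy integral; uniqueness of coefficients makes this an identity of formal
    series.\<close>
  then have "A * a = 1"
    using disc_series_unique disc_series_one by blast
  interpret G: stationary_gram \<phi> A a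
  proof
    show "norm (\<phi> n) = 1" for n
      using assms(1) by (simp add: stationary_def)
    show "cinner (\<phi> k) (\<phi> n) = fps_nth a (n - k)" if "k \<le> n" for k n
      using cinner_shift[OF assms(1) that] by (simp add: a_def)
  qed fact
  have B: "disc_series G.B (inner_fun \<mu>)"
    using disc_series_one_minus[OF A] by (simp add: G.B_def)
  \<comment> \<open>The upper bound is the contraction property applied to the unit impulse;
    singularity supplies the lower one.\<close>
  have "l2 G.B" "l2sq G.B \<le> 1"
    using G.B_contraction[OF l2_one(1)] l2_one(2) by simp_all
  moreover have "disc_series G.B (\<lambda>z. 1 - 1 / \<nu>.cauchy z)"
    using B by (rule disc_series_cong) (simp add: inner_fun_def mu_plus)
  ultimately have "l2sq G.B = 1"
    using \<nu>.inner_unimodular_mean[OF Z] by force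
  interpret G: effective_gram \<phi> A a
    by standard fact+
  have E: "disc_series E (\<lambda>z. \<Sum>n. \<epsilon> n * z ^ n)"
    using assms(6) by (simp add: disc_series_def fps_conv_radius_def E_def eval_fps_def)
  note c = disc_series_mult[OF A E]
  have "l2 (A * E)"
    using assms(8) disc_series_in_hardy2[OF c] by (simp add: hardy2_ominus_def)
  moreover have "(\<Sum>n. fps_nth (A * E) n * cnj (fps_nth (G.B ^ K * u) n)) = 0" if "l2 u" for u
  proof -
    note u = disc_series_of_l2[OF that]
    have "(\<lambda>z. inner_fun \<mu> z ^ K * eval_fps u z) \<in> mult_hardy2 (\<lambda>z. inner_fun \<mu> z ^ K)"
      using that disc_series_in_hardy2[OF u] by (auto simp: mult_hardy2_def)
    then have "hardy2_inner (\<lambda>z. (1 - inner_fun \<mu> z) * (\<Sum>n. \<epsilon> n * z ^ n))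
        (\<lambda>z. inner_fun \<mu> z ^ K * eval_fps u z) = 0"
      using assms(8) by (simp add: hardy2_ominus_def)
    then show ?thesis
      by (simp add: hardy2_inner_def taylor_coeff_disc_series[OF c]
          taylor_coeff_disc_series[OF disc_series_mult[OF disc_series_power[OF B] u]])
  qed
  ultimately obtain y where y: "(\<lambda>N. G.S N (A * E)) \<longlonglongrightarrow> y"
    and norm_y: "(norm y)\<^sup>2 \<le> real K * l2sq (A * E)"
    using G.S_tendsto_of_orthogonal by metis
  have coeff: "fps_nth (A * F) n = (\<Sum>j=0..n. \<alpha> (n - j) * fps_nth F j)" for F n
    by (subst mult.commute) (simp add: fps_mult_nth A_def mult.commute)
  have "(\<lambda>n. fps_nth (A * G.X x) n *\<^sub>C \<phi> n) sums x"
    using G.S_A_X_tendsto[of x] by (simp add: sums_def G.S_def)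
  then have 1: "summable (\<lambda>n. (\<Sum>j=0..n. \<alpha> (n - j) * cinner x (\<phi> j)) *\<^sub>C \<phi> n)"
    by (simp add: coeff sums_iff)
  have "(\<lambda>n. fps_nth (A * E) n *\<^sub>C \<phi> n) sums y"
    using y by (simp add: sums_def G.S_def)
  then have 2: "summable (\<lambda>n. (\<Sum>j=0..n. \<alpha> (n - j) * \<epsilon> j) *\<^sub>C \<phi> n)"
    and sum: "(\<Sum>n. (\<Sum>j=0..n. \<alpha> (n - j) * \<epsilon> j) *\<^sub>C \<phi> n) = y"
    by (simp_all add: coeff sums_iff E_def)
  have 3: "ereal (norm y) \<le> ereal (2 * sqrt (real K)) * l2_norm \<epsilon>"
  proof (cases "l2 E")
    case True
    have "(norm y)\<^sup>2 \<le> real K * (4 * l2sq E)"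
      using norm_y G.l2sq_A_mult_le[OF True] by (meson mult_left_mono of_nat_0_le_iff order_trans)
    then have "norm y \<le> sqrt (real K * (4 * l2sq E))"
      by (rule real_le_rsqrt)
    also have "\<dots> = 2 * sqrt (real K) * sqrt (l2sq E)"
      by (simp add: real_sqrt_mult)
    finally show ?thesis
      using True by (simp add: l2_norm_def l2_def l2sq_def E_def)
  next
    case False
    \<comment> \<open>K \<ge> 1 keeps the factor positive, so its product with \<infinity> is
      \<infinity> and not 0.\<close>
    then show ?thesis
      using assms(7) by (simp add: l2_norm_def l2_def E_def)
  qed
  show ?thesis
    using 1 2 3 sum by simp
qed

end
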